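(* Let $N$ be a positive integer and let $f,g\in R=\mathbb{Z}_N[x^{\pm},y^{\pm}]$. The $\mathbf{BB}_N(f,g)$ code is topological if and only if the quotient module $$\mathcal{Q}=\frac{R}{(f,g)}$$ is finite, where $(f,g)$ denotes the ideal of $R$ generated by $f$ and $g$.
   Context: $\mathbb{Z}_N=\mathbb{Z}/N\mathbb{Z}$; $R=\mathbb{Z}_N[x^{\pm},y^{\pm}]$ is the Laurent polynomial ring in two variables. For $h\in R$, $\bar h(x,y)=h(x^{-1},y^{-1})$. The $\mathbf{BB}_N(f,g)$ code (the $\mathbb{Z}_N$ qudit bivariate-bicycle code specified by $f,g\in R$) is described by the chain complex of $R$-modules $R^2\xrightarrow{\partial}R^4\xrightarrow{\varepsilon}R^2$ with $$\partial=\begin{pmatrix}\bar f&0\\ \bar g&0\\ 0&g\\ 0&-f\end{pmatrix},\qquad \varepsilon=\begin{pmatrix}0&0&f&g\\ -\bar g&\bar f&0&0\end{pmatrix}.$$ The code is called topological if $\ker\varepsilon=\operatorname{im}\partial$; equivalently, if the complex $R\xrightarrow{(g,-f)^T}R^2\xrightarrow{(f\ g)}R$ is exact at $R^2$. *)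

theory Defs
  imports
    "HOL-Library.Poly_Mapping"
    "HOL-Library.Product_Plus"
    "Jordan_Normal_Form.Matrix"
    "Berlekamp_Zassenhaus.Finite_Field"
begin

text \<open>
  \<open>'n mod_ring\<close> is the ring of integers modulo \<open>N = CARD('n)\<close>. The index type
  \<open>'n\<close> is only required to be finite, so \<open>N\<close> is an arbitrary positive integer; in
  particular \<open>N = 1\<close>, the zero ring, is allowed. For this reason the definitions below
  do not use the sort \<open>comm_ring_1\<close>, which would exclude it.

  A Laurent polynomial in \<open>x\<close>, \<open>y\<close> is a finitely supported coefficient function on
  exponent vectors: \<open>Poly_Mapping.lookup h (i, j)\<close> is the coefficient of \<open>x\<^sup>i y\<^sup>j\<close>,
  and the product of \<open>poly_mapping\<close> is the convolution.
\<close>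

type_synonym 'n laurent = "(int \<times> int) \<Rightarrow>\<^sub>0 'n mod_ring"

definition laurent_bar :: "'n::finite laurent \<Rightarrow> 'n laurent" where
  "laurent_bar h = Poly_Mapping.map_key uminus h"

lemma lookup_laurent_bar: "Poly_Mapping.lookup (laurent_bar h) (i, j) = Poly_Mapping.lookup h (- i, - j)"
  unfolding laurent_bar_def by (subst map_key.rep_eq) (auto simp: inj_def)

definition bb_boundary :: "'n::finite laurent \<Rightarrow> 'n laurent \<Rightarrow> 'n laurent mat" where
  "bb_boundary f g = mat_of_rows_list 2
     [[laurent_bar f, 0],
      [laurent_bar g, 0],
      [0, g],
      [0, - f]]"

definition bb_syndrome :: "'n::finite laurent \<Rightarrow> 'n laurent \<Rightarrow> 'n laurent mat" where
  "bb_syndrome f g = mat_of_rows_list 4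
     [[0, 0, f, g],
      [- laurent_bar g, laurent_bar f, 0, 0]]"

text \<open>
  \<open>mat_kernel\<close> from the matrix library requires \<open>comm_ring_1\<close>, hence this copy.
\<close>

definition mat_ker :: "'a::comm_ring mat \<Rightarrow> 'a vec set" where
  "mat_ker A = {v \<in> carrier_vec (dim_col A). A *\<^sub>v v = 0\<^sub>v (dim_row A)}"

definition mat_im :: "'a::comm_ring mat \<Rightarrow> 'a vec set" where
  "mat_im A = (\<lambda>v. A *\<^sub>v v) ` carrier_vec (dim_col A)"

definition bb_topological :: "'n::finite laurent \<Rightarrow> 'n laurent \<Rightarrow> bool" where
  "bb_topological f g \<longleftrightarrow> mat_ker (bb_syndrome f g) = mat_im (bb_boundary f g)"

definition is_ideal :: "'a::comm_ring set \<Rightarrow> bool" where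
  "is_ideal I \<longleftrightarrow> 0 \<in> I \<and> (\<forall>a\<in>I. \<forall>b\<in>I. a - b \<in> I) \<and> (\<forall>r. \<forall>a\<in>I. r * a \<in> I)"

definition ideal_generated :: "'a::comm_ring set \<Rightarrow> 'a set" where
  "ideal_generated S = \<Inter>{I. is_ideal I \<and> S \<subseteq> I}"

text \<open>The set of cosets of the ideal \<open>I\<close>, i.e. the underlying set of the quotient by \<open>I\<close>.\<close>

definition quotient_by :: "'a::comm_ring set \<Rightarrow> 'a set set" where
  "quotient_by I = UNIV // {(a, b). a - b \<in> I}"

end

theory Submission
  imports Defs
begin

text \<open>
  Everything is lifted to \<open>L = \<int>[x\<^sup>\<plusminus>, y\<^sup>\<plusminus>]\<close>, where exactness becomes a congruence condition modulo
  \<open>N\<close> and reduction to a prime divisor of \<open>N\<close> needs no change of coefficient ring.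

  If \<open>L/(f, g, N)\<close> is finite, the pigeonhole principle puts some \<open>x\<^sup>m - 1\<close> and \<open>y\<^sup>n - 1\<close> into the ideal.
  They annihilate the homology of the Koszul complex and form a regular sequence modulo \<open>N\<close>, so the
  complex is exact.

  Conversely, exactness modulo \<open>N\<close> descends to every prime \<open>p\<close> dividing \<open>N\<close>. Let \<open>d = r f + s g\<close> have the
  least possible \<open>y\<close>-width among the elements of \<open>(f, g)\<close> that are nonzero modulo \<open>p\<close>. Pseudo-division
  gives \<open>h f = q\<^sub>1 d\<close> and \<open>h g = q\<^sub>2 d\<close> with \<open>h\<close> in \<open>x\<close> alone, and cancelling \<open>d\<close> gives
  \<open>h = r q\<^sub>1 + s q\<^sub>2\<close>. Since \<open>q\<^sub>2 f = q\<^sub>1 g\<close>, exactness yields \<open>q\<^sub>2 = c g\<close> and \<open>q\<^sub>1 = c f\<close>, so \<open>h = c d\<close>.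
  Hence \<open>d\<close> is, up to a power of \<open>y\<close>, a polynomial in \<open>x\<close>. The same holds with \<open>x\<close> and \<open>y\<close> exchanged,
  and the quotient modulo \<open>p\<close> is finite.
\<close>

subsection \<open>Koszul exactness and ideals modulo an element\<close>

text \<open>Exactness of the Koszul complex at its middle term after reduction modulo
  \<open>n\<close>. Phrased by divisibility, so that the modulus can vary while the ring stays
  fixed.\<close>

definition koszul_exact :: "'a::comm_ring_1 \<Rightarrow> 'a \<Rightarrow> 'a \<Rightarrow> bool" where
  "koszul_exact n f g \<longleftrightarrow>
     (\<forall>a b. n dvd a * f + b * g \<longrightarrow> (\<exists>c. n dvd a - c * g \<and> n dvd b + c * f))"

text \<open>The preimage of the ideal \<open>(f, g)\<close> under reduction modulo \<open>n\<close>,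
  so its quotient is the quotient of the reduced ring.\<close>

definition ideal3 :: "'a::comm_ring_1 \<Rightarrow> 'a \<Rightarrow> 'a \<Rightarrow> 'a set" where
  "ideal3 n f g = {u * f + v * g + n * w | u v w. True}"

text \<open>Representatives, unlike cosets, can be combined by ring operations and moved along ring
  maps.\<close>

definition finite_index :: "'a::comm_ring set \<Rightarrow> bool" where
  "finite_index I \<longleftrightarrow> (\<exists>S. finite S \<and> (\<forall>r. \<exists>s\<in>S. r - s \<in> I))"

lemma koszul_exactD:
  assumes "koszul_exact n f g" "n dvd a * f + b * g"
  obtains c where "n dvd a - c * g" "n dvd b + c * f"
  using assms unfolding koszul_exact_def by blast

lemma koszul_exact_commute:
  assumes "koszul_exact n f g"
  shows "koszul_exact n g f"
  unfolding koszul_exact_def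
proof (intro allI impI)
  fix a b assume "n dvd a * g + b * f"
  then have "n dvd b * f + a * g" by (simp add: add.commute)
  then obtain c where "n dvd b - c * g" "n dvd a + c * f"
    using koszul_exactD[OF assms] by blast
  then show "\<exists>c. n dvd a - c * f \<and> n dvd b + c * g"
    by (intro exI[of _ "- c"]) simp
qed

text \<open>Multiplying by \<open>m\<close> turns a relation modulo \<open>n\<close> into one modulo
  \<open>n * m\<close>. Since \<open>v * m\<close> is 1 modulo \<open>n\<close>, multiplying the
  resulting \<open>c\<close> by \<open>v\<close> undoes this.\<close>

lemma koszul_exact_coprime_factor:
  fixes n :: "'a::comm_ring_1"
  assumes E: "koszul_exact (n * m) f g" and uv: "u * n + v * m = 1"
  shows "koszul_exact n f g"
  unfolding koszul_exact_def
proof (intro allI impI)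
  fix a b assume "n dvd a * f + b * g"
  then have "n * m dvd (a * f + b * g) * m" by (simp add: mult_dvd_mono)
  then have "n * m dvd (m * a) * f + (m * b) * g" by (simp add: algebra_simps)
  then obtain c where c: "n * m dvd m * a - c * g" "n * m dvd m * b + c * f"
    using koszul_exactD[OF E] by blast
  have "v * (m * a) + u * n * a = a" "v * (m * b) + u * n * b = b"
    using uv by (metis add.commute distrib_right mult.assoc mult_1)+
  then have "a - v * c * g = v * (m * a - c * g) + n * (u * a)"
    "b + v * c * f = v * (m * b + c * f) + n * (u * b)"
    by (simp_all add: algebra_simps)
  moreover have "n dvd m * a - c * g" "n dvd m * b + c * f"
    using c by (auto dest: dvd_mult_left)
  ultimately show "\<exists>c. n dvd a - c * g \<and> n dvd b + c * f"
    by (intro exI[of _ "v * c"]) (simp add: mult.assoc)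
qed

text \<open>Multiplying by \<open>p\<close> turns a relation modulo \<open>m\<close> into one modulo
  \<open>p * m\<close>. Its multiplier \<open>c\<close> satisfies \<open>p dvd c * f\<close> and
  \<open>p dvd c * g\<close>, so \<open>p\<close> divides \<open>c\<close>, and one factor
  \<open>p\<close> cancels throughout.\<close>

lemma koszul_exact_remove_prime:
  fixes p :: "'a::comm_ring_1"
  assumes E: "koszul_exact (p * m) f g" and p: "prime_elem p"
    and reg: "\<And>a. p * a = 0 \<Longrightarrow> a = 0" and nd: "\<not> (p dvd f \<and> p dvd g)"
  shows "koszul_exact m f g"
  unfolding koszul_exact_def
proof (intro allI impI)
  have cancel: "m dvd a" if dvd: "p * m dvd p * a" for a
  proof -
    obtain k where "p * a = p * m * k" using dvd by (elim dvdE)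
    then have "p * (a - m * k) = 0" by (simp add: algebra_simps)
    then show ?thesis using reg by fastforce
  qed
  fix a b assume "m dvd a * f + b * g"
  then have "p * m dvd p * (a * f + b * g)" by (simp add: mult_dvd_mono)
  then have "p * m dvd (p * a) * f + (p * b) * g" by (simp add: algebra_simps)
  then obtain c where c: "p * m dvd p * a - c * g" "p * m dvd p * b + c * f"
    using koszul_exactD[OF E] by blast
  have "p dvd p * a - c * g" "p dvd p * b + c * f"
    using c by (auto dest: dvd_mult_left)
  then have "p dvd c * g" "p dvd c * f"
    by (metis dvd_diff_right_iff dvd_triv_left, metis dvd_add_right_iff dvd_triv_left)
  then have "p dvd c" using p nd by (auto dest: prime_elem_dvd_multD)
  then obtain c' where c': "c = p * c'" ..
  have "p * a - c * g = p * (a - c' * g)" "p * b + c * f = p * (b + c' * f)"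
    by (simp_all add: c' algebra_simps)
  then show "\<exists>c. m dvd a - c * g \<and> m dvd b + c * f"
    using c cancel by metis
qed

section \<open>The ideal \<open>(f, g, n)\<close> and finiteness of its quotient\<close>

lemma is_ideal_ideal3: "is_ideal (ideal3 n f g)"
  unfolding is_ideal_def
proof (intro conjI ballI allI)
  have "0 = 0 * f + 0 * g + n * 0" by simp
  then show "0 \<in> ideal3 n f g" unfolding ideal3_def by blast
next
  fix a b assume "a \<in> ideal3 n f g" "b \<in> ideal3 n f g"
  then obtain u v w u' v' w' where "a = u * f + v * g + n * w" "b = u' * f + v' * g + n * w'"
    by (auto simp: ideal3_def)
  then have "a - b = (u - u') * f + (v - v') * g + n * (w - w')" by (simp add: algebra_simps)
  then show "a - b \<in> ideal3 n f g" unfolding ideal3_def by blast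
next
  fix r a assume "a \<in> ideal3 n f g"
  then obtain u v w where "a = u * f + v * g + n * w"
    by (auto simp: ideal3_def)
  then have "r * a = (r * u) * f + (r * v) * g + n * (r * w)" by (simp add: algebra_simps)
  then show "r * a \<in> ideal3 n f g" unfolding ideal3_def by blast
qed

lemma ideal3_dvd: "n dvd a \<Longrightarrow> a \<in> ideal3 n f g"
proof -
  assume "n dvd a"
  then obtain w where "a = 0 * f + 0 * g + n * w" by (auto elim: dvdE)
  then show ?thesis unfolding ideal3_def by blast
qed

lemma ideal3_gen: "f \<in> ideal3 n f g" "g \<in> ideal3 n f g"
proof -
  have "f = 1 * f + 0 * g + n * 0" "g = 0 * f + 1 * g + n * 0" by simp_all
  then show "f \<in> ideal3 n f g" "g \<in> ideal3 n f g" unfolding ideal3_def by blast+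
qed

lemma is_idealD:
  assumes "is_ideal (I :: 'a::comm_ring_1 set)"
  shows "0 \<in> I" "a \<in> I \<Longrightarrow> b \<in> I \<Longrightarrow> a - b \<in> I" "a \<in> I \<Longrightarrow> b \<in> I \<Longrightarrow> a + b \<in> I"
    "a \<in> I \<Longrightarrow> r * a \<in> I" "a \<in> I \<Longrightarrow> - a \<in> I"
proof -
  show *: "0 \<in> I" "a \<in> I \<Longrightarrow> b \<in> I \<Longrightarrow> a - b \<in> I" "a \<in> I \<Longrightarrow> r * a \<in> I" for a b r
    using assms unfolding is_ideal_def by blast+
  show n: "a \<in> I \<Longrightarrow> - a \<in> I" for a using *(2)[of 0 a] *(1) by simp
  show "a \<in> I \<Longrightarrow> b \<in> I \<Longrightarrow> a + b \<in> I" using *(2)[of a "- b"] n by simp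
qed

lemma is_ideal_sum:
  assumes "is_ideal (I :: 'a::comm_ring_1 set)" "\<And>k. k \<in> A \<Longrightarrow> h k \<in> I"
  shows "sum h A \<in> I"
  using assms(2)
  by (induction A rule: infinite_finite_induct) (auto intro: is_idealD[OF assms(1)])

text \<open>Two-digit expansion: write \<open>r\<close> as \<open>s + a * w\<close> modulo
  \<open>(f, g)\<close>, then \<open>w\<close> as \<open>t + b * w'\<close>; the elements
  \<open>s + a * t\<close> represent everything.\<close>

lemma finite_index_mult:
  assumes "finite_index (ideal3 a f g)" "finite_index (ideal3 b f g)"
  shows "finite_index (ideal3 (a * b) f g)"
proof -
  obtain S where S: "finite S" "\<And>r. \<exists>s\<in>S. r - s \<in> ideal3 a f g"
    using assms(1) unfolding finite_index_def by blast
  obtain T where T: "finite T" "\<And>r. \<exists>s\<in>T. r - s \<in> ideal3 b f g"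
    using assms(2) unfolding finite_index_def by blast
  have "\<exists>x\<in>(\<lambda>(s, t). s + a * t) ` (S \<times> T). r - x \<in> ideal3 (a * b) f g" for r
  proof -
    obtain s u v w where s: "s \<in> S" "r - s = u * f + v * g + a * w"
      using S(2)[of r] unfolding ideal3_def by blast
    obtain t u' v' w' where t: "t \<in> T" "w - t = u' * f + v' * g + b * w'"
      using T(2)[of w] unfolding ideal3_def by blast
    have "r = s + u * f + v * g + a * w" "w = t + u' * f + v' * g + b * w'"
      using s t by (metis add.assoc add.commute diff_add_cancel)+
    then have "r - (s + a * t) = (u + a * u') * f + (v + a * v') * g + (a * b) * w'"
      by (simp add: algebra_simps)
    then have "r - (s + a * t) \<in> ideal3 (a * b) f g" unfolding ideal3_def by blast
    with s t show ?thesis by force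
  qed
  moreover have "finite ((\<lambda>(s, t). s + a * t) ` (S \<times> T))" using S T by blast
  ultimately show ?thesis unfolding finite_index_def by blast
qed

lemma finite_quotient_iff:
  assumes "is_ideal I"
  shows "finite (quotient_by I) \<longleftrightarrow> finite_index I"
proof
  assume fin: "finite (quotient_by I)"
  let ?rep = "\<lambda>C. SOME s. s \<in> C"
  have "\<exists>s\<in>?rep ` quotient_by I. r - s \<in> I" for r
  proof
    let ?C = "{(a, b). a - b \<in> I} `` {r}"
    have "r \<in> ?C" using assms by (simp add: is_ideal_def)
    then have "?rep ?C \<in> ?C" by (rule someI)
    then show "r - ?rep ?C \<in> I" by simp
    show "?rep ?C \<in> ?rep ` quotient_by I"
      unfolding quotient_by_def by (intro imageI quotientI) simp
  qed
  then show "finite_index I" using fin unfolding finite_index_def by blast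
next
  assume "finite_index I"
  then obtain S where S: "finite S" "\<And>r. \<exists>s\<in>S. r - s \<in> I"
    unfolding finite_index_def by blast
  have diff: "a - b \<in> I" if "a \<in> I" "b \<in> I" for a b
    using assms that by (simp add: is_ideal_def)
  have neg: "- a \<in> I" if "a \<in> I" for a
    using diff[of 0 a] that assms by (simp add: is_ideal_def)
  have "quotient_by I \<subseteq> (\<lambda>s. {(a, b). a - b \<in> I} `` {s}) ` S"
  proof
    fix C assume "C \<in> quotient_by I"
    then obtain r where C: "C = {(a, b). a - b \<in> I} `` {r}"
      unfolding quotient_by_def by (auto elim: quotientE)
    obtain s where s: "s \<in> S" "r - s \<in> I" using S(2) by blast
    have "r - b \<in> I \<longleftrightarrow> s - b \<in> I" for b
      using diff[of "r - b" "r - s"] diff[of "s - b" "- (r - s)"] neg[OF s(2)] s(2) by auto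
    then have "C = {(a, b). a - b \<in> I} `` {s}" unfolding C by blast
    with s show "C \<in> (\<lambda>s. {(a, b). a - b \<in> I} `` {s}) ` S" by blast
  qed
  then show "finite (quotient_by I)" using S(1) by (meson finite_imageI finite_subset)
qed

subsection \<open>Supports and extreme slices of Laurent polynomials\<close>

abbreviation lookup :: "('k \<Rightarrow>\<^sub>0 'b::zero) \<Rightarrow> 'k \<Rightarrow> 'b" where
  "lookup \<equiv> Poly_Mapping.lookup"

abbreviation monom1 :: "'k \<Rightarrow> ('k \<Rightarrow>\<^sub>0 int)" where
  "monom1 k \<equiv> Poly_Mapping.single k 1"

text \<open>In a group the exponent of the first factor determines that of the second, which leaves
  a single sum. \<open>F\<close> may exceed the support, so that two products can be compared term
  by term.\<close>

lemma lookup_mult_group: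
  fixes a b :: "'k::ab_group_add \<Rightarrow>\<^sub>0 'b::semiring_0"
  assumes "finite F" "Poly_Mapping.keys a \<subseteq> F"
  shows "lookup (a * b) k = (\<Sum>l\<in>F. lookup a l * lookup b (k - l))"
proof -
  have "(k = l + q) = (q = k - l)" for l q :: 'k
    by (auto simp: algebra_simps)
  then have "lookup (a * b) k = Sum_any (\<lambda>l. lookup a l * lookup b (k - l))"
    by (simp add: lookup_mult)
  also have "\<dots> = (\<Sum>l\<in>F. lookup a l * lookup b (k - l))"
    using assms by (intro Sum_any.expand_superset) (use in_keys_iff mult_not_zero in fastforce)+
  finally show ?thesis .
qed

lemma lookup_monom1_mult:
  fixes a :: "'k::ab_group_add \<Rightarrow>\<^sub>0 int"
  shows "lookup (monom1 l * a) k = lookup a (k - l)"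
  by (subst lookup_mult_group[of "{l}"]) auto

lemma monom1_mult: "monom1 k * monom1 l = (monom1 (k + l) :: 'k::ab_group_add \<Rightarrow>\<^sub>0 int)"
  by (simp add: mult_single)

lemma lookup_of_int_mult:
  fixes a :: "'k::ab_group_add \<Rightarrow>\<^sub>0 int"
  shows "lookup (of_int n * a) k = n * lookup a k"
proof -
  have "of_int n = Poly_Mapping.single (0::'k) n"
    by (simp flip: single_of_int)
  then show ?thesis by (simp add: lookup_mult_group[of "{0}"])
qed

lemma of_int_dvd_iff:
  fixes a :: "'k::ab_group_add \<Rightarrow>\<^sub>0 int"
  shows "of_int n dvd a \<longleftrightarrow> (\<forall>k. n dvd lookup a k)"
proof
  assume "of_int n dvd a"
  then show "\<forall>k. n dvd lookup a k" by (auto elim!: dvdE simp: lookup_of_int_mult)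
next
  assume *: "\<forall>k. n dvd lookup a k"
  have "a = of_int n * Poly_Mapping.map (\<lambda>c. c div n) a"
    using * by (intro poly_mapping_eqI) (auto simp: lookup_of_int_mult Poly_Mapping.map.rep_eq when_def)
  then show "of_int n dvd a" by (rule dvdI)
qed

lemma of_int_mult_eq_0_iff:
  fixes a :: "'k::ab_group_add \<Rightarrow>\<^sub>0 int"
  assumes "n \<noteq> 0"
  shows "of_int n * a = 0 \<longleftrightarrow> a = 0"
  using assms by (auto simp: poly_mapping_eq_iff fun_eq_iff lookup_of_int_mult)

text \<open>The support of the reduction modulo \<open>n\<close>, read off the integer
  coefficients.\<close>

definition supp_mod :: "int \<Rightarrow> ('k \<Rightarrow>\<^sub>0 int) \<Rightarrow> 'k set" where
  "supp_mod n a = {k. \<not> n dvd lookup a k}"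

lemma finite_supp_mod [simp]: "finite (supp_mod n a)"
  by (rule finite_subset[of _ "Poly_Mapping.keys a"]) (auto simp: supp_mod_def in_keys_iff intro: ccontr)

lemma supp_mod_empty_iff:
  fixes a :: "'k::ab_group_add \<Rightarrow>\<^sub>0 int"
  shows "supp_mod n a = {} \<longleftrightarrow> of_int n dvd a"
  by (auto simp: supp_mod_def of_int_dvd_iff)

lemma supp_mod_diff: "supp_mod n (a - b) \<subseteq> supp_mod n a \<union> supp_mod n b"
  by (auto simp: supp_mod_def lookup_minus)

lemma supp_mod_monom1_mult:
  fixes a :: "'k::ab_group_add \<Rightarrow>\<^sub>0 int"
  shows "supp_mod n (monom1 l * a) = (+) l ` supp_mod n a"
proof -
  have "k \<in> (+) l ` supp_mod n a" if "k - l \<in> supp_mod n a" for k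
    using that by (intro image_eqI[of _ _ "k - l"]) auto
  then show ?thesis by (auto simp: supp_mod_def lookup_monom1_mult)
qed

lemma supp_mod_mult:
  fixes a b :: "'k::ab_group_add \<Rightarrow>\<^sub>0 int"
  assumes "k \<in> supp_mod n (a * b)"
  obtains l m where "l \<in> supp_mod n a" "m \<in> supp_mod n b" "k = l + m"
proof -
  have "lookup (a * b) k = (\<Sum>l\<in>Poly_Mapping.keys a. lookup a l * lookup b (k - l))"
    by (rule lookup_mult_group) auto
  with assms have "\<not> n dvd (\<Sum>l\<in>Poly_Mapping.keys a. lookup a l * lookup b (k - l))"
    by (simp add: supp_mod_def)
  then obtain l where "\<not> n dvd lookup a l * lookup b (k - l)"
    by (meson dvd_sum)
  then have "\<not> n dvd lookup a l" "\<not> n dvd lookup b (k - l)"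
    by (auto simp: dvd_mult dvd_mult2)
  then show ?thesis by (intro that[of l "k - l"]) (auto simp: supp_mod_def)
qed

text \<open>The homogeneous component of degree \<open>s\<close> when exponents are graded by
  \<phi>.\<close>

definition slice :: "('k \<Rightarrow> int) \<Rightarrow> int \<Rightarrow> ('k \<Rightarrow>\<^sub>0 int) \<Rightarrow> ('k \<Rightarrow>\<^sub>0 int)" where
  "slice \<phi> s a = Poly_Mapping.mapp (\<lambda>k c. if \<phi> k = s then c else 0) a"

lemma lookup_slice: "lookup (slice \<phi> s a) k = (if \<phi> k = s then lookup a k else 0)"
  by (simp add: slice_def lookup_mapp in_keys_iff when_def)

lemma supp_mod_slice: "supp_mod n (slice \<phi> s a) = {k \<in> supp_mod n a. \<phi> k = s}"
  by (auto simp: supp_mod_def lookup_slice)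

text \<open>An exponent of \<open>a\<close> below level \<open>s\<close> is paired with one of
  \<open>b\<close> above level \<open>t\<close>, where \<open>b\<close> vanishes modulo
  \<open>n\<close>; above level \<open>s\<close>, \<open>a\<close> itself vanishes. Only the two top
  slices contribute.\<close>

lemma lookup_mult_extreme:
  fixes a b :: "'k::ab_group_add \<Rightarrow>\<^sub>0 int"
  assumes \<phi>: "\<And>k l. \<phi> (k + l) = \<phi> k + \<phi> l"
    and a: "\<And>k. k \<in> supp_mod n a \<Longrightarrow> \<phi> k \<le> s" and b: "\<And>k. k \<in> supp_mod n b \<Longrightarrow> \<phi> k \<le> t"
    and k: "\<phi> k = s + t"
  shows "n dvd lookup (a * b) k - lookup (slice \<phi> s a * slice \<phi> t b) k"
proof -
  let ?F = "Poly_Mapping.keys a"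
  have sub: "Poly_Mapping.keys (slice \<phi> s a) \<subseteq> ?F"
    by (auto simp: in_keys_iff lookup_slice split: if_splits)
  have diff: "\<phi> (k - l) = s + t - \<phi> l" for l
    using \<phi>[of "k - l" l] k by simp
  have "n dvd lookup a l * lookup b (k - l) - lookup (slice \<phi> s a) l * lookup (slice \<phi> t b) (k - l)" for l
  proof (cases "\<phi> l" s rule: linorder_cases)
    case less
    then have "n dvd lookup b (k - l)" using b[of "k - l"] diff[of l] by (force simp: supp_mod_def)
    then show ?thesis using less by (simp add: lookup_slice dvd_mult)
  next
    case equal
    then show ?thesis by (simp add: lookup_slice diff)
  next
    case greater
    then have "n dvd lookup a l" using a[of l] by (force simp: supp_mod_def)
    then show ?thesis using greater by (simp add: lookup_slice dvd_mult2)
  qed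
  then have "n dvd (\<Sum>l\<in>?F. lookup a l * lookup b (k - l)
      - lookup (slice \<phi> s a) l * lookup (slice \<phi> t b) (k - l))"
    by (rule dvd_sum)
  then show ?thesis
    unfolding lookup_mult_group[OF finite_keys order_refl, of a] lookup_mult_group[OF finite_keys sub]
      sum_subtractf .
qed

lemma obtain_extreme:
  fixes a :: "'k::ab_group_add \<Rightarrow>\<^sub>0 int"
  assumes "\<not> of_int n dvd a"
  obtains s where "\<And>k. k \<in> supp_mod n a \<Longrightarrow> \<phi> k \<le> s" "\<not> of_int n dvd slice \<phi> s a"
proof
  let ?s = "Max (\<phi> ` supp_mod n a)"
  have ne: "supp_mod n a \<noteq> {}" using assms by (simp add: supp_mod_empty_iff)
  show "\<phi> k \<le> ?s" if "k \<in> supp_mod n a" for k using that by simp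
  have "?s \<in> \<phi> ` supp_mod n a" using ne by (intro Max_in) auto
  then obtain k where "k \<in> supp_mod n a" "\<phi> k = ?s" by auto
  then have "k \<in> supp_mod n (slice \<phi> ?s a)" by (simp add: supp_mod_slice)
  then show "\<not> of_int n dvd slice \<phi> ?s a" by (metis empty_iff supp_mod_empty_iff)
qed

text \<open>Lower levels cannot cancel the product of the top slices, so whatever survives there
  modulo \<open>n\<close> survives in \<open>a * b\<close>.\<close>

lemma supp_mod_mult_extreme:
  fixes a b :: "'k::ab_group_add \<Rightarrow>\<^sub>0 int"
  assumes \<phi>: "\<And>k l. \<phi> (k + l) = \<phi> k + \<phi> l"
    and a: "\<And>k. k \<in> supp_mod n a \<Longrightarrow> \<phi> k \<le> s" and b: "\<And>k. k \<in> supp_mod n b \<Longrightarrow> \<phi> k \<le> t"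
    and ab: "\<not> of_int n dvd slice \<phi> s a * slice \<phi> t b"
  obtains k where "k \<in> supp_mod n (a * b)" "\<phi> k = s + t"
proof -
  obtain k where k: "k \<in> supp_mod n (slice \<phi> s a * slice \<phi> t b)"
    using ab by (metis ex_in_conv supp_mod_empty_iff)
  then obtain l m where "l \<in> supp_mod n (slice \<phi> s a)" "m \<in> supp_mod n (slice \<phi> t b)" "k = l + m"
    by (rule supp_mod_mult)
  then have "\<phi> k = s + t" by (simp add: supp_mod_slice \<phi>)
  moreover from this have "n dvd lookup (a * b) k - lookup (slice \<phi> s a * slice \<phi> t b) k"
    by (intro lookup_mult_extreme \<phi> a b)
  with k have "k \<in> supp_mod n (a * b)"
    unfolding supp_mod_def mem_Collect_eq by (metis dvd_diff_right_iff)
  ultimately show ?thesis using that by blast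
qed

text \<open>Gauss's lemma by leading terms: the top slice in y, then the top slice of that in x,
  leaves one monomial of each factor, and \<open>p\<close> does not divide the product of their
  coefficients.\<close>

lemma prime_elem_of_int_laurent:
  assumes p: "prime p"
  shows "prime_elem (of_int p :: int \<times> int \<Rightarrow>\<^sub>0 int)"
proof -
  let ?P = "of_int p :: int \<times> int \<Rightarrow>\<^sub>0 int"
  have "\<not> ?P dvd a * b" if a: "\<not> ?P dvd a" and b: "\<not> ?P dvd b" for a b
  proof -
    obtain s where s: "\<And>k. k \<in> supp_mod p a \<Longrightarrow> snd k \<le> s" "\<not> ?P dvd slice snd s a"
      using obtain_extreme[OF a, of snd] by blast
    obtain t where t: "\<And>k. k \<in> supp_mod p b \<Longrightarrow> snd k \<le> t" "\<not> ?P dvd slice snd t b"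
      using obtain_extreme[OF b, of snd] by blast
    let ?a = "slice snd s a" and ?b = "slice snd t b"
    obtain s' where s': "\<And>k. k \<in> supp_mod p ?a \<Longrightarrow> fst k \<le> s'" "\<not> ?P dvd slice fst s' ?a"
      using obtain_extreme[OF s(2), of fst] by blast
    obtain t' where t': "\<And>k. k \<in> supp_mod p ?b \<Longrightarrow> fst k \<le> t'" "\<not> ?P dvd slice fst t' ?b"
      using obtain_extreme[OF t(2), of fst] by blast
    have sa: "slice fst s' ?a = Poly_Mapping.single (s', s) (lookup a (s', s))"
      by (rule poly_mapping_eqI) (auto simp: lookup_slice lookup_single when_def)
    have sb: "slice fst t' ?b = Poly_Mapping.single (t', t) (lookup b (t', t))"
      by (rule poly_mapping_eqI) (auto simp: lookup_slice lookup_single when_def)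
    have "\<not> p dvd lookup a (s', s)" "\<not> p dvd lookup b (t', t)"
      using s'(2) t'(2) unfolding sa sb of_int_dvd_iff by (auto simp: lookup_single when_def split: if_splits)
    then have "\<not> p dvd lookup a (s', s) * lookup b (t', t)"
      using p by (simp add: prime_dvd_mult_iff)
    then have "\<not> ?P dvd slice fst s' ?a * slice fst t' ?b"
      unfolding sa sb mult_single of_int_dvd_iff
      by (metis lookup_single_eq)
    then obtain k where "k \<in> supp_mod p (?a * ?b)"
      using supp_mod_mult_extreme[of fst, OF fst_add s'(1) t'(1)] by blast
    then have "\<not> ?P dvd ?a * ?b" by (metis empty_iff supp_mod_empty_iff)
    then obtain k where "k \<in> supp_mod p (a * b)"
      using supp_mod_mult_extreme[of snd, OF snd_add s(1) t(1)] by blast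
    then show ?thesis by (metis empty_iff supp_mod_empty_iff)
  qed
  moreover have "?P \<noteq> 0" using p by auto
  moreover have "\<not> ?P dvd 1"
  proof
    assume "?P dvd 1"
    then have "p dvd lookup (1 :: int \<times> int \<Rightarrow>\<^sub>0 int) 0" unfolding of_int_dvd_iff by blast
    then show False using p not_prime_unit[of p] by (simp add: lookup_one)
  qed
  ultimately show ?thesis unfolding prime_elem_def by blast
qed

subsection \<open>Ideals modulo a prime\<close>

text \<open>In the next lemmas \<open>\<phi>\<close> is one of the two exponents of a monomial and \<open>E i\<close> is the \<open>i\<close>-th
  power of the corresponding variable.\<close>

lemma supp_mod_single_slice:
  fixes c d :: "int \<times> int \<Rightarrow>\<^sub>0 int"
  assumes p: "prime p" and \<phi>: "\<And>k l. \<phi> (k + l) = \<phi> k + \<phi> l"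
    and c: "\<not> of_int p dvd c" and d: "\<not> of_int p dvd d"
    and cd: "\<And>k. k \<in> supp_mod p (c * d) \<Longrightarrow> \<phi> k = (0::int)"
  obtains t where "\<And>k. k \<in> supp_mod p d \<Longrightarrow> \<phi> k = t"
proof -
  have prime: "prime_elem (of_int p :: int \<times> int \<Rightarrow>\<^sub>0 int)"
    using p by (rule prime_elem_of_int_laurent)
  \<comment> \<open>Top degrees add in a product because \<open>p\<close> is prime. Applied to
    \<phi> and to its negative, this bounds the levels of both factors from above and below.\<close>
  have bounds: "\<exists>s t. (\<forall>k\<in>supp_mod p c. \<psi> k \<le> s) \<and> (\<forall>k\<in>supp_mod p d. \<psi> k \<le> t) \<and> s + t = 0"
    if \<psi>: "\<And>k l. \<psi> (k + l) = \<psi> k + \<psi> l" and cd: "\<And>k. k \<in> supp_mod p (c * d) \<Longrightarrow> \<psi> k = 0"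
    for \<psi> :: "int \<times> int \<Rightarrow> int"
  proof -
    obtain s where s: "\<And>k. k \<in> supp_mod p c \<Longrightarrow> \<psi> k \<le> s" "\<not> of_int p dvd slice \<psi> s c"
      using obtain_extreme[OF c, of \<psi>] by blast
    obtain t where t: "\<And>k. k \<in> supp_mod p d \<Longrightarrow> \<psi> k \<le> t" "\<not> of_int p dvd slice \<psi> t d"
      using obtain_extreme[OF d, of \<psi>] by blast
    have "\<not> of_int p dvd slice \<psi> s c * slice \<psi> t d"
      using prime s(2) t(2) by (auto dest: prime_elem_dvd_multD)
    then obtain k where "k \<in> supp_mod p (c * d)" "\<psi> k = s + t"
      using supp_mod_mult_extreme[of \<psi>, OF \<psi> s(1) t(1)] by blast
    then show ?thesis using cd s(1) t(1) by metis
  qed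
  obtain s t where st: "\<forall>k\<in>supp_mod p c. \<phi> k \<le> s" "\<forall>k\<in>supp_mod p d. \<phi> k \<le> t" "s + t = 0"
    using bounds[OF \<phi> cd] by blast
  obtain s' t' where st': "\<forall>k\<in>supp_mod p c. - \<phi> k \<le> s'" "\<forall>k\<in>supp_mod p d. - \<phi> k \<le> t'" "s' + t' = 0"
    using bounds[of "\<lambda>k. - \<phi> k"] \<phi> cd by force
  obtain k0 l0 where "k0 \<in> supp_mod p c" "l0 \<in> supp_mod p d"
    using c d unfolding supp_mod_empty_iff[symmetric] by blast
  then have "- s' \<le> s" "- t' \<le> t" using st st' by (meson minus_le_iff order_trans)+
  \<comment> \<open>The widths \<open>s + s'\<close> and \<open>t + t'\<close> are nonnegative with
    sum 0, so both vanish.\<close>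
  with st(3) st'(3) have "- t' = t" by linarith
  then show ?thesis using st(2) st'(2) by (intro that[of t]) (force intro: order_antisym)
qed

text \<open>The least-width argument needs only that \<phi> is additive and that a monomial
  \<open>E i\<close> of every degree exists, so it serves both variables. With \<phi> the exponent
  of y it yields an element in x alone modulo \<open>p\<close>.\<close>

lemma ideal_single_slice:
  fixes f g :: "int \<times> int \<Rightarrow>\<^sub>0 int"
  assumes p: "prime p" and \<phi>: "\<And>k l. \<phi> (k + l) = \<phi> k + \<phi> l" and E: "\<And>i. \<phi> (E i) = (i::int)"
    and nd: "\<not> (of_int p dvd f \<and> of_int p dvd g)" and exact: "koszul_exact (of_int p) f g"
  obtains d where "d \<in> ideal3 (of_int p) f g" "\<not> of_int p dvd d"
    "\<And>k. k \<in> supp_mod p d \<Longrightarrow> \<phi> k = 0"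
proof -
  note [simp del] = split_paired_All split_paired_Ex
  let ?P = "of_int p :: int \<times> int \<Rightarrow>\<^sub>0 int"
  let ?J = "ideal3 ?P f g"
  note J = is_idealD[OF is_ideal_ideal3[of ?P f g]]
  have prime: "prime_elem ?P" using p by (rule prime_elem_of_int_laurent)
  have notdvd_mult: "\<not> ?P dvd a * b" if "\<not> ?P dvd a" "\<not> ?P dvd b" for a b
    using prime that by (auto dest: prime_elem_dvd_multD)
  have notdvd_monom: "\<not> ?P dvd monom1 l * a \<longleftrightarrow> \<not> ?P dvd a" for l a
    unfolding supp_mod_empty_iff[symmetric] supp_mod_monom1_mult by simp
  \<comment> \<open>A width bound, normalised to start at level 0; \<open>m = 0\<close> forces
    \<open>a\<close> to vanish modulo \<open>p\<close>.\<close>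
  define rows where "rows m a \<longleftrightarrow> (\<forall>k\<in>supp_mod p a. 0 \<le> \<phi> k \<and> \<phi> k < int m)"
    for m and a :: "int \<times> int \<Rightarrow>\<^sub>0 int"
  have rows_exist: "\<exists>l m. rows m (monom1 (E l) * a)" for a
  proof -
    \<comment> \<open>If \<open>a\<close> vanishes modulo \<open>p\<close>, these extremes are
      unspecified, but then there is no level to bound.\<close>
    let ?b = "Min (\<phi> ` supp_mod p a)" and ?t = "Max (\<phi> ` supp_mod p a)"
    have "rows (nat (?t - ?b + 1)) (monom1 (E (- ?b)) * a)"
      unfolding rows_def supp_mod_monom1_mult
    proof (intro ballI, elim imageE)
      fix k k' assume "k' \<in> supp_mod p a" and k: "k = E (- ?b) + k'"
      then have "?b \<le> \<phi> k'" "\<phi> k' \<le> ?t" by simp_all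
      then show "0 \<le> \<phi> k \<and> \<phi> k < int (nat (?t - ?b + 1))" by (simp add: k \<phi> E)
    qed
    then show ?thesis by blast
  qed
  let ?good = "\<lambda>m. \<exists>d\<in>?J. \<not> ?P dvd d \<and> rows m d"
  have good_ex: "\<exists>m. ?good m"
  proof -
    obtain a where a: "a \<in> ?J" "\<not> ?P dvd a" using nd ideal3_gen by metis
    with rows_exist[of a] J(4) notdvd_monom show ?thesis by meson
  qed
  define n where "n = (LEAST m. ?good m)"
  have least: "\<not> ?good m" if "m < n" for m
    using that unfolding n_def by (rule not_less_Least)
  have "?good n" unfolding n_def using good_ex by (rule LeastI_ex)
  then obtain d where d: "d \<in> ?J" "\<not> ?P dvd d" "rows n d" by blast
  have "n \<noteq> 0"
  proof
    assume "n = 0"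
    with d(3) have "supp_mod p d = {}" by (auto simp: rows_def)
    with d(2) show False by (simp add: supp_mod_empty_iff)
  qed
  then obtain n' where n': "n = Suc n'" by (cases n) auto
  let ?D = "slice \<phi> (int n') d"
  \<comment> \<open>If the top slice vanished, \<open>d\<close> would fit into \<open>n'\<close>
    levels, against minimality.\<close>
  have D: "\<not> ?P dvd ?D"
  proof
    assume "?P dvd ?D"
    then have "supp_mod p ?D = {}" by (simp add: supp_mod_empty_iff)
    then have "\<phi> k \<noteq> int n'" if "k \<in> supp_mod p d" for k using \<open>supp_mod p ?D = {}\<close> that unfolding supp_mod_slice by blast
    then have "rows n' d" using d(3) unfolding rows_def n' by force
    with least[of n'] d n' show False by blast
  qed
  \<comment> \<open>Pseudo-division by induction on the number of levels of \<open>a\<close>. Each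
    genuine division step multiplies by the leading slice \<open>?D\<close> moved to level 0, and
    these factors build up \<open>h\<close>.\<close>
  have pseudo: "\<exists>h q. (\<forall>k\<in>supp_mod p h. \<phi> k = 0) \<and> \<not> ?P dvd h \<and> ?P dvd h * a - q * d"
    if "a \<in> ?J" "rows m a" for a m
    using that
  proof (induction m arbitrary: a)
    case 0
    then have "supp_mod p a = {}" by (auto simp: rows_def)
    then have "?P dvd a" by (simp add: supp_mod_empty_iff)
    moreover have "\<phi> 0 = 0" using \<phi>[of 0 0] by simp
    then have "\<forall>k\<in>supp_mod p 1. \<phi> k = 0" by (auto simp: supp_mod_def lookup_one when_def)
    moreover have "\<not> ?P dvd 1" using prime by (simp add: prime_elem_def)
    ultimately show ?case by (intro exI[of _ 1] exI[of _ 0]) simp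
  next
    case (Suc m)
    show ?case
    proof (cases "m < n'")
      case True
      \<comment> \<open>An ideal element that is nonzero modulo \<open>p\<close> needs at least
        \<open>n\<close> levels, and \<open>Suc m\<close> is at most \<open>n'\<close>.\<close>
      then have "?P dvd a" using least[of "Suc m"] Suc.prems n' by blast
      then have "supp_mod p a = {}" by (simp add: supp_mod_empty_iff)
      then have "rows m a" by (simp add: rows_def)
      then show ?thesis using Suc by blast
    next
      case False
      let ?A = "slice \<phi> (int m) a" and ?X = "monom1 (E (- int n'))"
      \<comment> \<open>The two products agree modulo \<open>p\<close> on the top level
        \<open>n' + m\<close>, which cancels. Neither reaches below level \<open>n'\<close>, because
        \<open>n' \<le> m\<close>, so the shift by \<open>?X\<close> leaves \<open>m\<close>
        levels.\<close>
      let ?a = "?D * a - ?A * d"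
      have slice_slice: "slice \<phi> s (slice \<phi> s b) = slice \<phi> s b" for s b
        by (rule poly_mapping_eqI) (simp add: lookup_slice)
      have bd: "\<phi> k \<le> int n'" "0 \<le> \<phi> k" if "k \<in> supp_mod p d" for k
        using d(3) that unfolding rows_def n' by auto
      have ba: "\<phi> k \<le> int m" "0 \<le> \<phi> k" if "k \<in> supp_mod p a" for k
        using Suc.prems that unfolding rows_def by auto
      have bnd: "int n' \<le> \<phi> k \<and> \<phi> k < int n' + int m" if k: "k \<in> supp_mod p ?a" for k
      proof -
        have "k \<in> supp_mod p (?D * a) \<or> k \<in> supp_mod p (?A * d)" 
          using subsetD[OF supp_mod_diff k] by simp
        then have 1: "int n' \<le> \<phi> k \<and> \<phi> k \<le> int n' + int m"
        proof (elim disjE)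
          assume "k \<in> supp_mod p (?D * a)"
          then obtain i j where "i \<in> supp_mod p ?D" "j \<in> supp_mod p a" "k = i + j"
            by (rule supp_mod_mult)
          then show "int n' \<le> \<phi> k \<and> \<phi> k \<le> int n' + int m" using ba[of j] by (auto simp: supp_mod_slice \<phi>)
        next
          assume "k \<in> supp_mod p (?A * d)"
          then obtain i j where "i \<in> supp_mod p ?A" "j \<in> supp_mod p d" "k = i + j"
            by (rule supp_mod_mult)
          then show "int n' \<le> \<phi> k \<and> \<phi> k \<le> int n' + int m"
            using bd[of j] False by (auto simp: supp_mod_slice \<phi>)
        qed
        have "\<phi> k \<noteq> int n' + int m"
        proof
          assume eq: "\<phi> k = int n' + int m"
          have "p dvd lookup (?D * a) k - lookup (slice \<phi> (int n') ?D * ?A) k"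
            using eq ba by (intro lookup_mult_extreme \<phi>) (auto simp: supp_mod_slice)
          moreover have "p dvd lookup (?A * d) k - lookup (slice \<phi> (int m) ?A * ?D) k"
            using eq bd by (intro lookup_mult_extreme \<phi>) (auto simp: supp_mod_slice)
          ultimately have "p dvd (lookup (?D * a) k - lookup (?D * ?A) k)
              - (lookup (?A * d) k - lookup (?A * ?D) k)"
            unfolding slice_slice by (rule dvd_diff)
          then have "p dvd lookup ?a k" by (simp add: lookup_minus mult.commute)
          with k show False by (simp add: supp_mod_def)
        qed
        with 1 show ?thesis by simp
      qed
      have "rows m (?X * ?a)"
        unfolding rows_def supp_mod_monom1_mult
      proof (intro ballI, elim imageE)
        fix k k' assume "k' \<in> supp_mod p ?a" and k: "k = E (- int n') + k'"
        then show "0 \<le> \<phi> k \<and> \<phi> k < int m" using bnd[of k'] by (simp add: k \<phi> E)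
      qed
      moreover have "?X * ?a \<in> ?J" using Suc.prems(1) d(1) by (intro J(2) J(4))
      ultimately obtain h q where h: "\<forall>k\<in>supp_mod p h. \<phi> k = 0" "\<not> ?P dvd h"
          "?P dvd h * (?X * ?a) - q * d"
        using Suc.IH by blast
      have "h * (?X * ?a) - q * d = (h * (?X * ?D)) * a - (q + h * (?X * ?A)) * d"
        by (simp add: algebra_simps)
      then have "?P dvd (h * (?X * ?D)) * a - (q + h * (?X * ?A)) * d" using h(3) by metis
      moreover have "\<not> ?P dvd h * (?X * ?D)"
        using D h(2) notdvd_mult notdvd_monom by blast
      moreover have "\<phi> k = 0" if "k \<in> supp_mod p (h * (?X * ?D))" for k
      proof -
        obtain i j where "i \<in> supp_mod p h" "j \<in> supp_mod p (?X * ?D)" "k = i + j"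
          using \<open>k \<in> supp_mod p (h * (?X * ?D))\<close> by (rule supp_mod_mult)
        then show ?thesis using h(1) by (auto simp: supp_mod_monom1_mult supp_mod_slice \<phi> E)
      qed
      ultimately show ?thesis by blast
    qed
  qed
  \<comment> \<open>Monomials are units: \<open>a\<close> is first shifted to start at level 0, and
    the shift is then absorbed into the quotient.\<close>
  have pseudo': "\<exists>h q. (\<forall>k\<in>supp_mod p h. \<phi> k = 0) \<and> \<not> ?P dvd h \<and> ?P dvd h * a - q * d"
    if "a \<in> ?J" for a
  proof -
    obtain l m where "rows m (monom1 (E l) * a)" using rows_exist by blast
    moreover have "monom1 (E l) * a \<in> ?J" using \<open>a \<in> ?J\<close> by (rule J(4))
    ultimately obtain h q where h: "\<forall>k\<in>supp_mod p h. \<phi> k = 0" "\<not> ?P dvd h"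
        "?P dvd h * (monom1 (E l) * a) - q * d"
      using pseudo by blast
    have "monom1 (- E l) * monom1 (E l) = (1 :: int \<times> int \<Rightarrow>\<^sub>0 int)"
      by (simp only: monom1_mult ab_left_minus single_one)
    moreover have "monom1 (- E l) * (h * (monom1 (E l) * a)) = monom1 (- E l) * monom1 (E l) * (h * a)"
      by (simp only: ac_simps)
    ultimately have "h * a = monom1 (- E l) * (h * (monom1 (E l) * a))" by simp
    then have "h * a - (monom1 (- E l) * q) * d = monom1 (- E l) * (h * (monom1 (E l) * a) - q * d)"
      by (simp add: algebra_simps)
    then have "?P dvd h * a - (monom1 (- E l) * q) * d" using h(3) by simp
    with h show ?thesis by blast
  qed
  obtain h1 q1 where h1: "\<forall>k\<in>supp_mod p h1. \<phi> k = 0" "\<not> ?P dvd h1" "?P dvd h1 * f - q1 * d"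
    using pseudo'[of f] ideal3_gen by blast
  obtain h2 q2 where h2: "\<forall>k\<in>supp_mod p h2. \<phi> k = 0" "\<not> ?P dvd h2" "?P dvd h2 * g - q2 * d"
    using pseudo'[of g] ideal3_gen by blast
  \<comment> \<open>A common multiplier for the divisions of \<open>f\<close> and of
    \<open>g\<close>.\<close>
  let ?h = "h1 * h2"
  have hf: "?P dvd ?h * f - (h2 * q1) * d"
  proof -
    have "?h * f - (h2 * q1) * d = h2 * (h1 * f - q1 * d)" by (simp add: algebra_simps)
    then show ?thesis using h1(3) by simp
  qed
  have hg: "?P dvd ?h * g - (h1 * q2) * d"
  proof -
    have "?h * g - (h1 * q2) * d = h1 * (h2 * g - q2 * d)" by (simp add: algebra_simps)
    then show ?thesis using h2(3) by simp
  qed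
  define F G where "F = h2 * q1" and "G = h1 * q2"
  have h: "\<not> ?P dvd ?h" using notdvd_mult h1(2) h2(2) by blast
  \<comment> \<open>Cross-multiplication eliminates \<open>d\<close>; cancelling \<open>?h\<close>
    makes \<open>(G, - F)\<close> a syzygy modulo \<open>p\<close>.\<close>
  have "?h * (G * f - F * g) = G * (?h * f - F * d) - F * (?h * g - G * d)"
    by (simp add: algebra_simps)
  then have "?P dvd ?h * (G * f - F * g)" using hf hg by (simp add: F_def G_def)
  then have "?P dvd G * f + (- F) * g" using h prime by (auto dest: prime_elem_dvd_multD)
  then obtain c where c: "?P dvd G - c * g" "?P dvd - F + c * f"
    using koszul_exactD[OF exact] by blast
  obtain r s w where rsw: "d = r * f + s * g + ?P * w" using d(1) by (auto simp: ideal3_def)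
  \<comment> \<open>Modulo \<open>p\<close>, both \<open>?h * d\<close> and \<open>c * d * d\<close>
    equal \<open>(r * F + s * G) * d\<close>: the first by the divisions, the second by
    \<open>F = c * f\<close> and \<open>G = c * g\<close>. Then \<open>d\<close> cancels.\<close>
  have "(?h - c * d) * d = (?h - c * d) * (r * f + s * g + ?P * w)" by (simp flip: rsw)
  also have "\<dots> = r * (?h * f - F * d) + s * (?h * g - G * d) + ?h * (?P * w)
      - r * d * (- F + c * f) + s * d * (G - c * g) - c * d * (?P * w)"
    by (simp add: algebra_simps)
  also have "?P dvd \<dots>"
    using hf hg c by (intro dvd_diff dvd_add) (simp_all add: F_def G_def)
  finally have "?P dvd ?h - c * d" using d(2) prime by (auto dest: prime_elem_dvd_multD)
  then have supp: "supp_mod p (c * d) = supp_mod p ?h"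
    unfolding of_int_dvd_iff supp_mod_def lookup_minus by (metis dvd_diff_commute dvd_diff_right_iff)
  have "\<phi> k = 0" if "k \<in> supp_mod p (c * d)" for k
  proof -
    obtain i j where "i \<in> supp_mod p h1" "j \<in> supp_mod p h2" "k = i + j"
      using \<open>k \<in> supp_mod p (c * d)\<close> unfolding supp by (rule supp_mod_mult)
    then show ?thesis using h1(1) h2(1) by (simp add: \<phi>)
  qed
  moreover have "\<not> ?P dvd c * d" using h unfolding supp_mod_empty_iff[symmetric] supp .
  then have "\<not> ?P dvd c" by auto
  ultimately obtain t where t: "\<And>k. k \<in> supp_mod p d \<Longrightarrow> \<phi> k = t"
    using supp_mod_single_slice[of p \<phi>, OF p \<phi> _ d(2)] by blast
  show ?thesis
  proof
    show "monom1 (E (- t)) * d \<in> ?J" using d(1) by (rule J(4))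
    show "\<not> ?P dvd monom1 (E (- t)) * d" using d(2) notdvd_monom by blast
    show "\<phi> k = 0" if "k \<in> supp_mod p (monom1 (E (- t)) * d)" for k
      using that t unfolding supp_mod_monom1_mult by (auto simp: \<phi> E)
  qed
qed

subsection \<open>Roots of unity in ideals\<close>

lemma monom1_hom:
  assumes "\<And>i j. E (i + j) = E i + (E j :: 'k::ab_group_add)"
  shows "monom1 (E i) * monom1 (E j) = monom1 (E (i + j))" "monom1 (E (0::int)) = 1"
proof -
  have "E 0 = 0" using assms[of 0 0] by simp
  then show "monom1 (E 0) = 1" by simp
qed (simp add: monom1_mult assms)

text \<open>Two powers share a representative, and their difference can be divided by the lower
  power because monomials are units.\<close>

lemma pigeonhole_monom:
  fixes I :: "('k::ab_group_add \<Rightarrow>\<^sub>0 int) set"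
  assumes I: "is_ideal I" and E: "\<And>i j. E (i + j) = E i + (E j :: 'k)"
    and T: "finite T" "\<And>n. \<exists>t\<in>T. monom1 (E (int n)) - t \<in> I"
  obtains m :: int where "m > 0" "monom1 (E m) - 1 \<in> I"
proof -
  obtain t where t: "\<And>n. t n \<in> T" "\<And>n. monom1 (E (int n)) - t n \<in> I"
    using T(2) by metis
  have "\<not> inj t"
    using t(1) T(1) by (meson finite_imageD finite_subset image_subsetI infinite_UNIV_nat)
  then obtain i j where ij: "i < j" "t i = t j"
    by (metis injI linorder_neqE_nat)
  have "(monom1 (E (int j)) - t j) - (monom1 (E (int i)) - t i) \<in> I"
    by (intro is_idealD(2)[OF I] t(2))
  then have "monom1 (E (int j)) - monom1 (E (int i)) \<in> I" using ij(2) by simp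
  then have "monom1 (E (- int i)) * (monom1 (E (int j)) - monom1 (E (int i))) \<in> I"
    by (rule is_idealD(4)[OF I])
  then have "monom1 (E (int j - int i)) - 1 \<in> I"
    by (simp add: right_diff_distrib monom1_hom[of E, OF E])
  then show ?thesis using ij(1) by (intro that[of "int j - int i"]) auto
qed

lemma finite_reps_supp_mod:
  assumes "finite S" "n > 0"
  obtains T :: "('k::ab_group_add \<Rightarrow>\<^sub>0 int) set"
  where "finite T" "\<And>a. supp_mod n a \<subseteq> S \<Longrightarrow> \<exists>t\<in>T. of_int n dvd a - t"
proof
  let ?T = "{a :: 'k \<Rightarrow>\<^sub>0 int. (\<forall>k. (k \<in> S \<longrightarrow> lookup a k \<in> {0..<n}) \<and> (k \<notin> S \<longrightarrow> lookup a k = 0))}"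
  have "finite (lookup ` ?T)"
    by (rule finite_subset[OF _ finite_set_of_finite_funs[OF assms(1), of "{0..<n}" 0]]) blast+
  moreover have "inj_on lookup ?T" by (rule inj_onI) (simp only: poly_mapping_eq_iff)
  ultimately show "finite ?T" by (rule finite_imageD)
  show "\<exists>t\<in>?T. of_int n dvd a - t" if "supp_mod n a \<subseteq> S" for a
  proof
    let ?t = "Poly_Mapping.map (\<lambda>c. c mod n) a"
    have lookup: "lookup ?t k = lookup a k mod n" for k
      by (simp add: Poly_Mapping.map.rep_eq when_def)
    show "of_int n dvd a - ?t"
      by (simp add: of_int_dvd_iff lookup_minus lookup mod_eq_dvd_iff[symmetric])
    have "lookup a k mod n = 0" if "k \<notin> S" for k
      using that \<open>supp_mod n a \<subseteq> S\<close> by (auto simp: supp_mod_def mod_eq_0_iff_dvd)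
    then show "?t \<in> ?T" using assms(2) by (simp add: lookup)
  qed
qed

text \<open>Since \<open>p\<close> is prime, the top coefficient of \<open>d\<close> is invertible modulo \<open>p\<close>, so division by \<open>d\<close>
  leaves only finitely many residues for the powers \<open>E i\<close>.\<close>

lemma ideal_contains_unity_power:
  fixes I :: "('k::ab_group_add \<Rightarrow>\<^sub>0 int) set"
  assumes I: "is_ideal I" and p: "prime p" "\<And>a. of_int p dvd a \<Longrightarrow> a \<in> I"
    and E: "\<And>i j. E (i + j) = E i + (E j :: 'k)" "inj E"
    and d: "d \<in> I" "\<not> of_int p dvd d" "supp_mod p d \<subseteq> range E"
  obtains m :: int where "m > 0" "monom1 (E m) - 1 \<in> I"
proof -
  note J = is_idealD[OF I]
  note hom = monom1_hom[of E, OF E(1)]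
  define A where "A = {i. E i \<in> supp_mod p d}"
  have EA: "E ` A = supp_mod p d" using d(3) by (auto simp: A_def)
  have fin: "finite A"
    using finite_supp_mod[of p d] E(2) unfolding EA[symmetric] by (metis finite_imageD inj_on_subset subset_UNIV)
  have ne: "A \<noteq> {}" using d(2) EA by (auto simp: supp_mod_empty_iff[symmetric])
  define l t where "l = Min A" and "t = Max A"
  define D where "D = nat (t - l)"
  have "t \<in> A" unfolding t_def using fin ne by (rule Max_in)
  then have "l \<le> t" "\<not> p dvd lookup d (E t)" using fin by (auto simp: l_def A_def supp_mod_def)
  then have "coprime p (lookup d (E t))" using p(1) by (simp add: prime_imp_coprime)
  then obtain v where v: "[lookup d (E t) * v = 1] (mod p)"
    using cong_solve_coprime_int coprime_commute by blast
  \<comment> \<open>\<open>d\<close> with its lowest exponent moved to 0 and its top coefficient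
    made 1 modulo \<open>p\<close>: a monic polynomial of degree \<open>D\<close>.\<close>
  define e where "e = of_int v * (monom1 (E (- l)) * d)"
  have e: "e \<in> I" unfolding e_def using d(1) by (intro J(4))
  have Ediff: "E (i - j) = E i - E j" for i j using E(1)[of "i - j" j] by (simp add: algebra_simps)
  have "E 0 = 0" using Ediff[of 0 0] by simp
  then have lookup_e: "lookup e (E i) = v * lookup d (E (i + l))" for i
    using Ediff[of 0 l] by (simp add: e_def lookup_of_int_mult lookup_monom1_mult E(1))
  have e_top: "[lookup e (E (int D)) = 1] (mod p)"
    using v \<open>l \<le> t\<close> by (simp add: lookup_e D_def mult.commute)
  have supp_e: "supp_mod p e \<subseteq> E ` {0..int D}"
  proof
    fix k assume "k \<in> supp_mod p e"
    then have "k \<in> supp_mod p (monom1 (E (- l)) * d)"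
      by (auto simp: e_def supp_mod_def lookup_of_int_mult)
    then obtain i where "i \<in> A" "k = E (- l) + E i" unfolding supp_mod_monom1_mult EA[symmetric] by blast
    then have "k = E (i - l)" "l \<le> i" "i \<le> t" using fin Ediff[of 0 l] Ediff[of i l] \<open>E 0 = 0\<close>
      by (auto simp: l_def t_def Ediff)
    then show "k \<in> E ` {0..int D}" by (auto simp: D_def)
  qed
  \<comment> \<open>One division step, clearing exponent \<open>D\<close>. It suffices for all
    powers, since multiplication by \<open>E 1\<close> raises a remainder to exponent
    \<open>D\<close> at most.\<close>
  have reduce: "\<exists>b. a - b \<in> I \<and> supp_mod p b \<subseteq> E ` {0..<int D}" if a: "supp_mod p a \<subseteq> E ` {0..int D}" for a
  proof (intro exI conjI)
    let ?c = "lookup a (E (int D))"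
    let ?b = "a - of_int ?c * e"
    show "a - ?b \<in> I" using J(4)[OF e] by simp
    have "p dvd ?c - ?c * lookup e (E (int D))"
      using cong_mult[OF cong_refl e_top, of ?c] by (simp add: cong_iff_dvd_diff dvd_diff_commute)
    then have "E (int D) \<notin> supp_mod p ?b" by (simp add: supp_mod_def lookup_minus lookup_of_int_mult)
    moreover have "supp_mod p (of_int ?c * e) \<subseteq> supp_mod p e"
      by (auto simp: supp_mod_def lookup_of_int_mult)
    then have "supp_mod p ?b \<subseteq> E ` {0..int D}" using supp_mod_diff[of p a "of_int ?c * e"] a supp_e by blast
    moreover have "{0..int D} = insert (int D) {0..<int D}" by auto
    ultimately show "supp_mod p ?b \<subseteq> E ` {0..<int D}" by auto
  qed
  have residue: "\<exists>b. monom1 (E (int n)) - b \<in> I \<and> supp_mod p b \<subseteq> E ` {0..<int D}" for n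
  proof (induction n)
    case 0
    \<comment> \<open>The closed range contains 0 even for \<open>D = 0\<close>; in that case
      \<open>e\<close> is 1 modulo \<open>p\<close> and every residue vanishes modulo
      \<open>p\<close>.\<close>
    have "supp_mod p (monom1 (E 0)) \<subseteq> E ` {0..int D}"
      by (auto simp: supp_mod_def lookup_single when_def)
    then show ?case using reduce by simp
  next
    case (Suc n)
    then obtain b where b: "monom1 (E (int n)) - b \<in> I" "supp_mod p b \<subseteq> E ` {0..<int D}" by blast
    have "supp_mod p (monom1 (E 1) * b) \<subseteq> E ` {0..int D}"
      unfolding supp_mod_monom1_mult using b(2) by (force simp flip: E(1))
    then obtain b' where b': "monom1 (E 1) * b - b' \<in> I" "supp_mod p b' \<subseteq> E ` {0..<int D}"
      using reduce by blast
    have "monom1 (E 1) * (monom1 (E (int n)) - b) + (monom1 (E 1) * b - b') \<in> I"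
      by (intro J(3) J(4) b(1) b'(1))
    then have "monom1 (E (int (Suc n))) - b' \<in> I" by (simp add: right_diff_distrib hom)
    with b' show ?case by blast
  qed
  obtain T :: "('k \<Rightarrow>\<^sub>0 int) set" where T: "finite T"
      "\<And>a. supp_mod p a \<subseteq> E ` {0..<int D} \<Longrightarrow> \<exists>t\<in>T. of_int p dvd a - t"
    using finite_reps_supp_mod[of "E ` {0..<int D}" p] prime_gt_0_int[OF p(1)] by blast
  have "\<exists>t\<in>T. monom1 (E (int n)) - t \<in> I" for n
  proof -
    obtain b where b: "monom1 (E (int n)) - b \<in> I" "supp_mod p b \<subseteq> E ` {0..<int D}"
      using residue by blast
    then obtain t where t: "t \<in> T" "b - t \<in> I" using T(2) p(2) by blast
    then have "(monom1 (E (int n)) - b) + (b - t) \<in> I" using b by (intro J(3))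
    with t show ?thesis by auto
  qed
  with T(1) show ?thesis using pigeonhole_monom[OF I E(1)] that by blast
qed

text \<open>For a monomial z, z^(q+1) - 1 = z (z^q - 1) + (z - 1), and the downward step uses that z
  is a unit. Negative \<open>q\<close> arise as quotients of negative exponents.\<close>

lemma unity_power_dvd:
  fixes E :: "int \<Rightarrow> 'k::ab_group_add"
  assumes E: "\<And>i j. E (i + j) = E i + E j"
  shows "monom1 (E m) - 1 dvd monom1 (E (q * m)) - 1"
proof (induction q rule: int_induct[of _ 0])
  case base
  show ?case by (simp add: monom1_hom[of E, OF E])
next
  case (step1 q)
  have eq: "monom1 (E ((q + 1) * m)) = monom1 (E m) * monom1 (E (q * m))"
    by (simp add: monom1_hom[of E, OF E] distrib_right add.commute)
  have main: "monom1 (E ((q + 1) * m)) - 1 = monom1 (E m) * (monom1 (E (q * m)) - 1) + (monom1 (E m) - 1)"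
    unfolding eq by (simp add: right_diff_distrib)
  show ?case unfolding main using step1(2) by (intro dvd_add dvd_mult) simp_all
next
  case (step2 q)
  have eq: "monom1 (E ((q - 1) * m)) = monom1 (E (- m)) * monom1 (E (q * m))"
    by (simp add: monom1_hom[of E, OF E] left_diff_distrib)
  have inv: "monom1 (E (- m)) * monom1 (E m) = 1"
    by (simp add: monom1_hom[of E, OF E])
  have "monom1 (E ((q - 1) * m)) - 1
      = monom1 (E (- m)) * (monom1 (E (q * m)) - 1) - monom1 (E (- m)) * (monom1 (E m) - 1)"
    unfolding eq by (simp add: right_diff_distrib inv)
  then show ?case using step2 by simp
qed

lemma sum_single_lookup:
  "(\<Sum>k\<in>Poly_Mapping.keys a. Poly_Mapping.single k (lookup a k)) = a"
  by (rule poly_mapping_eqI) (simp add: lookup_sum lookup_single when_def in_keys_iff)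

text \<open>Congruences between monomials extend by linearity; \<rho> will reduce exponents modulo a
  period.\<close>

lemma ideal_normal_form:
  fixes I :: "('k::ab_group_add \<Rightarrow>\<^sub>0 int) set"
  assumes I: "is_ideal I" and \<rho>: "\<And>k. monom1 k - monom1 (\<rho> k) \<in> I"
  obtains b where "a - b \<in> I" "Poly_Mapping.keys b \<subseteq> range \<rho>"
proof
  let ?b = "\<Sum>k\<in>Poly_Mapping.keys a. Poly_Mapping.single (\<rho> k) (lookup a k)"
  have single: "Poly_Mapping.single k c = of_int c * monom1 k" for k :: 'k and c
    by (rule poly_mapping_eqI) (simp add: lookup_of_int_mult lookup_single when_def)
  have "a - ?b = (\<Sum>k\<in>Poly_Mapping.keys a. Poly_Mapping.single k (lookup a k)) - ?b"
    by (simp add: sum_single_lookup)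
  also have "\<dots> = (\<Sum>k\<in>Poly_Mapping.keys a. of_int (lookup a k) * (monom1 k - monom1 (\<rho> k)))"
    unfolding sum_subtractf[symmetric]
    by (intro sum.cong refl) (simp only: right_diff_distrib single[of _ "lookup a _"])
  also have "\<dots> \<in> I" by (intro is_ideal_sum I is_idealD(4)[OF I] \<rho>)
  finally show "a - ?b \<in> I" .
  have "Poly_Mapping.keys ?b \<subseteq> (\<Union>k\<in>Poly_Mapping.keys a. Poly_Mapping.keys (Poly_Mapping.single (\<rho> k) (lookup a k)))"
    by (rule keys_sum)
  also have "\<dots> \<subseteq> range \<rho>" by auto
  finally show "Poly_Mapping.keys ?b \<subseteq> range \<rho>" .
qed

subsection \<open>Exactness implies finiteness\<close>

text \<open>Factors \<open>p\<close> are stripped one at a time: primality moves each into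
  \<open>c\<close>, and regularity cancels it.\<close>

lemma prime_elem_power_dvd_cancel:
  fixes p :: "'a::comm_ring_1"
  assumes p: "prime_elem p" and reg: "\<And>a. p * a = 0 \<Longrightarrow> a = 0" and f: "\<not> p dvd f"
  shows "p ^ n dvd c * f \<Longrightarrow> p ^ n dvd c"
proof (induction n arbitrary: c)
  case (Suc n)
  have "p dvd c * f" using Suc.prems by (metis dvd_mult_left power_Suc)
  then have "p dvd c" using p f by (auto dest: prime_elem_dvd_multD)
  then obtain c' where c': "c = p * c'" ..
  obtain w where "c * f = p ^ Suc n * w" using Suc.prems ..
  then have "p * (c' * f - p ^ n * w) = 0" by (simp add: c' algebra_simps)
  then have "c' * f = p ^ n * w" using reg by fastforce
  then have "p ^ n dvd c'" using Suc.IH by simp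
  then show ?case by (simp add: c' mult_dvd_mono)
qed simp

text \<open>If \<open>p\<^sup>j\<close> is the largest power of \<open>p\<close> dividing \<open>p\<^sup>k\<close>, \<open>f\<close> and \<open>g\<close>, then \<open>(p\<^sup>k\<^sup>-\<^sup>j, 0)\<close> and
  \<open>(0, p\<^sup>k\<^sup>-\<^sup>j)\<close> are syzygies modulo \<open>p\<^sup>k\<close>, and they are not both Koszul when \<open>j > 0\<close>.\<close>

lemma koszul_exact_prime_power:
  fixes p :: "'a::comm_ring_1"
  assumes p: "prime_elem p" and reg: "\<And>a. p * a = 0 \<Longrightarrow> a = 0" and k: "k > 0"
    and exact: "koszul_exact (p ^ k) f g"
  shows "\<not> (p dvd f \<and> p dvd g)"
proof
  assume pfg: "p dvd f \<and> p dvd g"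
  have not_unit: "\<not> p dvd 1" using p by (simp add: prime_elem_def)
  have reg_pow: "a = 0" if "p ^ n * a = 0" for n a
    using that by (induction n) (auto dest: reg simp: mult.assoc)
  have cancel: "p ^ i dvd a" if "p ^ (j + i) dvd p ^ j * a" for i j a
  proof -
    obtain w where "p ^ j * a = p ^ (j + i) * w" using \<open>p ^ (j + i) dvd p ^ j * a\<close> ..
    then have "p ^ j * (a - p ^ i * w) = 0" by (simp add: power_add algebra_simps)
    then show ?thesis using reg_pow by fastforce
  qed
  \<comment> \<open>The cutoff \<open>j \<le> k\<close> makes the maximum exist even for
    \<open>f = g = 0\<close>.\<close>
  define j where "j = (GREATEST j. j \<le> k \<and> p ^ j dvd f \<and> p ^ j dvd g)"
  have j: "j \<le> k \<and> p ^ j dvd f \<and> p ^ j dvd g"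
    unfolding j_def by (rule GreatestI_nat[of _ 0 k]) auto
  have max: "i \<le> j" if "i \<le> k" "p ^ i dvd f" "p ^ i dvd g" for i
    unfolding j_def by (rule Greatest_le_nat[of _ _ k]) (use that in auto)
  have "j \<ge> 1" using max[of 1] pfg k by simp
  obtain f1 where f1: "f = p ^ j * f1" using j by blast
  obtain g1 where g1: "g = p ^ j * g1" using j by blast
  \<comment> \<open>Stated for a general pair, since the maximality of \<open>j\<close> may be
    witnessed by \<open>f\<close> or by \<open>g\<close>.\<close>
  have main: False
    if ex: "koszul_exact (p ^ k) F G" and F: "F = p ^ j * F1" and G: "p ^ j dvd G"
      and or: "j = k \<or> \<not> p dvd F1" for F G F1
  proof -
    let ?q = "p ^ (k - j)"
    have k_eq: "k = j + (k - j)" using j by simp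
    have pk: "p ^ k = p ^ j * ?q" using k_eq by (metis power_add)
    have "p ^ k dvd ?q * F + 0 * G" unfolding pk F by (intro dvdI[of _ _ F1]) (simp add: ac_simps)
    then obtain c where c: "p ^ k dvd ?q - c * G" "p ^ k dvd 0 + c * F"
      using koszul_exactD[OF ex] by blast
    show False
    proof (cases "j = k")
      case True
      then have "p ^ k dvd 1 - c * G" "p ^ k dvd c * G" using c G by simp_all
      then have "p ^ k dvd 1" by (metis dvd_diffD1 diff_add_cancel dvd_add)
      then show False using k not_unit dvd_trans[of p "p ^ k" 1] by simp
    next
      case False
      \<comment> \<open>Since \<open>c * F\<close> vanishes modulo \<open>p ^ k\<close>,
        \<open>?q\<close> divides \<open>c\<close>, so \<open>p ^ k\<close> divides
        \<open>c * G\<close> and hence \<open>?q\<close>; this makes \<open>p ^ j\<close> a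
        unit.\<close>
      have "p ^ (j + (k - j)) dvd p ^ j * (c * F1)"
        using c(2) k_eq by (simp add: F mult.left_commute)
      then have "?q dvd c * F1" by (rule cancel)
      then have "?q dvd c" using prime_elem_power_dvd_cancel[OF p reg] or False by blast
      then have "p ^ k dvd c * G" unfolding pk using G by (subst mult.commute) (rule mult_dvd_mono)
      then have "p ^ k dvd ?q" using c(1) by (metis diff_add_cancel dvd_add)
      then have "p ^ ((k - j) + j) dvd p ^ (k - j) * 1" using k_eq by simp
      then have "p ^ j dvd 1" by (rule cancel)
      then show False using \<open>j \<ge> 1\<close> not_unit dvd_trans[of p "p ^ j" 1] by simp
    qed
  qed
  show False
  proof (cases "j = k \<or> \<not> p dvd f1")
    case True
    then show False using main[OF exact f1] j by blast
  next
    case False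
    moreover have "\<not> (p dvd f1 \<and> p dvd g1)"
    proof
      assume "p dvd f1 \<and> p dvd g1"
      then have "p ^ Suc j dvd f" "p ^ Suc j dvd g"
        unfolding f1 g1 power_Suc2 by (simp_all add: mult_dvd_mono)
      with max[of "Suc j"] False j show False by auto
    qed
    ultimately show False using main[OF koszul_exact_commute[OF exact] g1] j by blast
  qed
qed

text \<open>Bezout splits off the \<open>p\<close>-part of \<open>N\<close>, to which the prime
  power case applies.\<close>

lemma koszul_exact_mod_not_both:
  fixes f g :: "int \<times> int \<Rightarrow>\<^sub>0 int"
  assumes N: "N > 0" and exact: "koszul_exact (of_int N) f g" and p: "prime p" "p dvd N"
  shows "\<not> (of_int p dvd f \<and> of_int p dvd g)"
proof -
  obtain k m where m: "N = p ^ k * m" "\<not> p dvd m" and k: "k > 0"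
  proof -
    obtain m where "N = p ^ multiplicity p N * m" "\<not> p dvd m"
      using multiplicity_decompose'[of N p] N not_prime_unit[of p] p(1) by blast
    moreover have "multiplicity p N > 0"
      using N p not_prime_unit[of p] by (subst multiplicity_gt_zero_iff) auto
    ultimately show ?thesis by (rule that)
  qed
  have "coprime (p ^ k) m" using m(2) p(1) by (simp add: prime_imp_coprime)
  moreover obtain u v where "u * p ^ k + v * m = gcd (p ^ k) m"
    using bezout_int by blast
  ultimately have "u * p ^ k + v * m = 1" by (simp only: coprime_imp_gcd_eq_1)
  then have "of_int (u * p ^ k + v * m) = (of_int 1 :: int \<times> int \<Rightarrow>\<^sub>0 int)" by (rule arg_cong)
  then have uv: "of_int u * of_int p ^ k + of_int v * of_int m = (1 :: int \<times> int \<Rightarrow>\<^sub>0 int)" by simp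
  have "koszul_exact (of_int p ^ k * of_int m) f g" using exact m(1) by simp
  then have ex: "koszul_exact (of_int p ^ k) f g" using uv by (rule koszul_exact_coprime_factor)
  have reg: "a = 0" if "of_int p * a = 0" for a :: "int \<times> int \<Rightarrow>\<^sub>0 int"
    using that p(1) of_int_mult_eq_0_iff[of p a] by auto
  show ?thesis
    by (rule koszul_exact_prime_power[OF prime_elem_of_int_laurent[OF p(1)] reg k ex])
qed

text \<open>The prime factors of the cofactor of \<open>M\<close> in \<open>N\<close> are removed
  one at a time.\<close>

lemma koszul_exact_mod_divisor:
  fixes f g :: "int \<times> int \<Rightarrow>\<^sub>0 int"
  assumes "N > 0" "koszul_exact (of_int N) f g" "M dvd N" "M > 0"
    "\<And>p. prime p \<Longrightarrow> p dvd N \<Longrightarrow> \<not> (of_int p dvd f \<and> of_int p dvd g)"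
  shows "koszul_exact (of_int M) f g"
  using assms
proof (induction "nat N" arbitrary: N rule: less_induct)
  case less
  obtain r where r: "N = M * r" using less.prems(3) ..
  have "r > 0" using less.prems r by (simp add: zero_less_mult_iff)
  show ?case
  proof (cases "r = 1")
    case True
    then show ?thesis using less.prems r by simp
  next
    case False
    then obtain p where p: "prime p" "p dvd r"
      using prime_divisor_exists[of r] \<open>r > 0\<close> by auto
    then obtain s where s: "r = p * s" by blast
    have "p > 1" using p(1) prime_gt_1_int by blast
    have "s > 0" using \<open>r > 0\<close> s \<open>p > 1\<close> by (simp add: zero_less_mult_iff)
    have N: "N = p * (M * s)" using r s by simp
    have "M * s > 0" using \<open>s > 0\<close> less.prems by simp
    have ex: "koszul_exact (of_int p * of_int (M * s)) f g" using less.prems(2) by (simp add: N)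
    have nd: "\<not> (of_int p dvd f \<and> of_int p dvd g)" using less.prems(5)[of p] p(1) N by simp
    have reg: "a = 0" if "of_int p * a = 0" for a :: "int \<times> int \<Rightarrow>\<^sub>0 int"
      using that \<open>p > 1\<close> of_int_mult_eq_0_iff[of p a] by simp
    have "koszul_exact (of_int (M * s)) f g"
      by (rule koszul_exact_remove_prime[OF ex prime_elem_of_int_laurent[OF p(1)] reg nd])
    moreover have "nat (M * s) < nat N" 
      using mult_strict_right_mono[OF \<open>p > 1\<close> \<open>M * s > 0\<close>] \<open>M * s > 0\<close> N by simp
    moreover have "\<not> (of_int q dvd f \<and> of_int q dvd g)" if "prime q" "q dvd M * s" for q
      using that less.prems(5)[of q] N by simp
    ultimately show ?thesis using less.hyps[of "M * s"] less.prems \<open>M * s > 0\<close> by simp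
  qed
qed

text \<open>\<open>finite_index_mult\<close> splits off one prime at a time; for
  \<open>N = 1\<close> the ideal is the whole ring.\<close>

lemma finite_index_prime_induct:
  fixes f g :: "int \<times> int \<Rightarrow>\<^sub>0 int"
  assumes "N > 0" "\<And>p. prime p \<Longrightarrow> p dvd N \<Longrightarrow> finite_index (ideal3 (of_int p) f g)"
  shows "finite_index (ideal3 (of_int N) f g)"
  using assms
proof (induction "nat N" arbitrary: N rule: less_induct)
  case less
  show ?case
  proof (cases "N = 1")
    case True
    then show ?thesis unfolding finite_index_def by (auto intro!: exI[of _ "{0}"] ideal3_dvd)
  next
    case False
    then obtain p where p: "prime p" "p dvd N"
      using prime_divisor_exists[of N] less.prems(1) by auto
    then obtain M where M: "N = p * M" by blast
    have "p > 1" using p(1) prime_gt_1_int by blast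
    then have "M > 0" using less.prems(1) M by (simp add: zero_less_mult_iff)
    then have "nat M < nat N" using M \<open>p > 1\<close> by simp
    then have "finite_index (ideal3 (of_int M) f g)"
      using less.hyps \<open>M > 0\<close> less.prems(2) M by simp
    then show ?thesis
      using finite_index_mult[OF less.prems(2)[OF p]] by (simp add: M)
  qed
qed

text \<open>The monomials with exponents in an \<open>m\<close> by \<open>m'\<close> box span the
  quotient, with coefficients that matter only modulo \<open>n\<close>.\<close>

lemma finite_index_unity_powers:
  fixes I :: "(int \<times> int \<Rightarrow>\<^sub>0 int) set"
  assumes I: "is_ideal I" and n: "n > 0" "\<And>a. of_int n dvd a \<Longrightarrow> a \<in> I"
    and x: "m > 0" "monom1 (m, 0) - 1 \<in> I" and y: "m' > 0" "monom1 (0, m') - 1 \<in> I"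
  shows "finite_index I"
proof -
  note J = is_idealD[OF I]
  have reduce: "monom1 (E i) - monom1 (E (i mod m)) \<in> I"
    if E: "\<And>i j. E (i + j) = E i + E j" and m: "monom1 (E m) - 1 \<in> I"
    for E :: "int \<Rightarrow> int \<times> int" and m i
  proof -
    obtain c where "monom1 (E (i div m * m)) - 1 = (monom1 (E m) - 1) * c"
      using unity_power_dvd[of E m "i div m", OF E] by (elim dvdE)
    then have "monom1 (E (i div m * m)) - 1 \<in> I" using J(4)[OF m, of c] by (simp add: mult.commute)
    then have "monom1 (E (i mod m)) * (monom1 (E (i div m * m)) - 1) \<in> I" by (rule J(4))
    then show ?thesis by (simp add: right_diff_distrib monom1_hom[of E, OF E])
  qed
  let ?\<rho> = "\<lambda>k. (fst k mod m, snd k mod m')"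
  have \<rho>: "monom1 k - monom1 (?\<rho> k) \<in> I" for k
  proof -
    obtain i j where k: "k = (i, j)" by (cases k)
    have 1: "monom1 (i, 0) - monom1 (i mod m, 0) \<in> I"
      using x(2) by (intro reduce[of "\<lambda>i. (i, 0)"]) simp_all
    have 2: "monom1 (0, j) - monom1 (0, j mod m') \<in> I"
      using y(2) by (intro reduce[of "\<lambda>j. (0, j)"]) simp_all
    have split: "(monom1 (a, b) :: int \<times> int \<Rightarrow>\<^sub>0 int) = monom1 (a, 0) * monom1 (0, b)" for a b
      by (simp add: mult_single)
    have "monom1 (i, j) - monom1 (i mod m, j mod m')
        = monom1 (0, j) * (monom1 (i, 0) - monom1 (i mod m, 0))
          + monom1 (i mod m, 0) * (monom1 (0, j) - monom1 (0, j mod m'))"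
      unfolding split[of i j] split[of "i mod m" "j mod m'"] by (simp add: algebra_simps)
    also have "\<dots> \<in> I" by (intro J(3) J(4) 1 2)
    finally show ?thesis by (simp add: k)
  qed
  let ?S = "{0..<m} \<times> {0..<m'}"
  obtain T where T: "finite T" "\<And>a. supp_mod n a \<subseteq> ?S \<Longrightarrow> \<exists>t\<in>T. of_int n dvd a - t"
    using finite_reps_supp_mod[of ?S n] n(1) by blast
  have "\<exists>t\<in>T. a - t \<in> I" for a
  proof -
    obtain b where b: "a - b \<in> I" "Poly_Mapping.keys b \<subseteq> range ?\<rho>"
      using ideal_normal_form[OF I \<rho>] by blast
    have "range ?\<rho> \<subseteq> ?S" using x(1) y(1) by auto
    moreover have "supp_mod n b \<subseteq> Poly_Mapping.keys b"
      by (auto simp: supp_mod_def in_keys_iff intro: ccontr)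
    ultimately obtain t where t: "t \<in> T" "of_int n dvd b - t" using b(2) T(2)[of b] by blast
    then have "(a - b) + (b - t) \<in> I" using b(1) n(2) by (intro J(3))
    with t(1) show ?thesis by auto
  qed
  with T(1) show ?thesis unfolding finite_index_def by blast
qed

lemma koszul_exact_imp_finite_index:
  fixes f g :: "int \<times> int \<Rightarrow>\<^sub>0 int"
  assumes N: "N > 0" and exact: "koszul_exact (of_int N) f g"
  shows "finite_index (ideal3 (of_int N) f g)"
proof (rule finite_index_prime_induct[OF N])
  fix p assume p: "prime p" "p dvd N"
  let ?I = "ideal3 (of_int p) f g"
  have not_both: "\<not> (of_int q dvd f \<and> of_int q dvd g)" if "prime q" "q dvd N" for q
    using koszul_exact_mod_not_both[OF N exact that] .
  have "p > 0" using p(1) by (rule prime_gt_0_int)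
  then have exact_p: "koszul_exact (of_int p) f g"
    using koszul_exact_mod_divisor[OF N exact p(2)] not_both by blast
  note I = is_ideal_ideal3[of "of_int p" f g]
  \<comment> \<open>Degree 0 in y modulo \<open>p\<close> means an element in x alone, which
    controls the powers of x; hence \<open>snd\<close> here goes with \<open>(i, 0)\<close>
    below.\<close>
  obtain d where d: "d \<in> ?I" "\<not> of_int p dvd d" "\<And>k. k \<in> supp_mod p d \<Longrightarrow> snd k = 0"
    using ideal_single_slice[of p snd "\<lambda>j. (0, j)" f g] p(1) not_both[OF p] exact_p by auto
  have "supp_mod p d \<subseteq> range (\<lambda>i. (i, 0))" using d(3) by force
  then obtain m where m: "m > 0" "monom1 (m, 0) - 1 \<in> ?I"
    using ideal_contains_unity_power[OF I p(1) ideal3_dvd _ _ d(1,2), of "\<lambda>i. (i, 0)"]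
    by (auto simp: inj_def)
  obtain e where e: "e \<in> ?I" "\<not> of_int p dvd e" "\<And>k. k \<in> supp_mod p e \<Longrightarrow> fst k = 0"
    using ideal_single_slice[of p fst "\<lambda>i. (i, 0)" f g] p(1) not_both[OF p] exact_p by auto
  have "supp_mod p e \<subseteq> range (\<lambda>j. (0, j))" using e(3) by force
  then obtain m' where m': "m' > 0" "monom1 (0, m') - 1 \<in> ?I"
    using ideal_contains_unity_power[OF I p(1) ideal3_dvd _ _ e(1,2), of "\<lambda>j. (0, j)"]
    by (auto simp: inj_def)
  show "finite_index ?I"
    using finite_index_unity_powers[OF I \<open>p > 0\<close> ideal3_dvd m m'] .
qed

subsection \<open>Finiteness implies exactness\<close>

text \<open>Modulo \<open>n\<close> the coefficients are constant along an infinite progression,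
  which must leave the finite support of \<open>a\<close>. The sign of \<open>m\<close> selects the
  direction.\<close>

lemma dvd_lookup_of_periodic:
  fixes a :: "'k::ab_group_add \<Rightarrow>\<^sub>0 int"
  assumes E: "\<And>i j. E (i + j) = E i + (E j :: 'k)" "inj E" and m: "m \<noteq> 0"
    and per: "\<And>i::nat. n dvd lookup a (k + E (int i * m)) - lookup a (k + E ((int i + 1) * m))"
  shows "n dvd lookup a k"
proof -
  have "E 0 = 0" using E(1)[of 0 0] by simp
  have *: "n dvd lookup a k - lookup a (k + E (int i * m))" for i
  proof (induction i)
    case 0
    then show ?case by (simp add: \<open>E 0 = 0\<close>)
  next
    case (Suc i)
    have "n dvd (lookup a k - lookup a (k + E (int i * m)))
        + (lookup a (k + E (int i * m)) - lookup a (k + E ((int i + 1) * m)))"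
      by (intro dvd_add Suc per)
    then show ?case by (simp add: add.commute)
  qed
  have "inj (\<lambda>i::nat. k + E (int i * m))"
    using m by (auto simp: inj_def dest!: injD[OF E(2)])
  then have "\<not> range (\<lambda>i::nat. k + E (int i * m)) \<subseteq> Poly_Mapping.keys a"
    using finite_keys by (meson finite_imageD finite_subset infinite_UNIV_nat)
  then obtain i where "lookup a (k + E (int i * m)) = 0" by (auto simp: in_keys_iff)
  with *[of i] show ?thesis by simp
qed

lemma lookup_unity_mult:
  fixes a :: "'k::ab_group_add \<Rightarrow>\<^sub>0 int"
  shows "lookup ((monom1 l - 1) * a) k = lookup a (k - l) - lookup a k"
  by (simp add: left_diff_distrib lookup_minus lookup_monom1_mult)

lemma unity_nonzerodivisor:
  fixes E :: "int \<Rightarrow> 'k::ab_group_add" and a :: "'k \<Rightarrow>\<^sub>0 int"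
  assumes E: "\<And>i j. E (i + j) = E i + (E j :: 'k)" "inj E" and m: "m \<noteq> 0"
    and dvd: "of_int n dvd (monom1 (E m) - 1) * a"
  shows "of_int n dvd a"
  unfolding of_int_dvd_iff
proof
  fix k
  have per: "n dvd lookup a (k + E (int i * m)) - lookup a (k + E ((int i + 1) * m))" for i
  proof -
    have "k + E ((int i + 1) * m) - E m = k + E (int i * m)"
      by (simp add: distrib_right E(1))
    moreover have "n dvd lookup ((monom1 (E m) - 1) * a) (k + E ((int i + 1) * m))"
      using dvd unfolding of_int_dvd_iff by blast
    ultimately show ?thesis by (simp only: lookup_unity_mult)
  qed
  show "n dvd lookup a k"
    by (rule dvd_lookup_of_periodic[of E m n a k, OF E m per])
qed

text \<open>Once \<open>c\<close> is reduced to x-exponents in \<open>{0..<m}\<close>, the multiple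
  of x^m - 1 vanishes modulo \<open>n\<close> outside that strip, which forces its cofactor to
  vanish modulo \<open>n\<close>. Thus y^m' - 1 is a nonzerodivisor modulo x^m - 1 and
  \<open>n\<close>.\<close>

lemma unity_regular_sequence:
  fixes c d :: "int \<times> int \<Rightarrow>\<^sub>0 int"
  assumes m: "m > 0" and m': "m' > 0"
    and cd: "of_int n dvd (monom1 (0, m') - 1) * c - (monom1 (m, 0) - 1) * d"
  obtains e where "of_int n dvd c - (monom1 (m, 0) - 1) * e"
proof -
  let ?u = "monom1 (m, 0) - 1 :: int \<times> int \<Rightarrow>\<^sub>0 int" and ?w = "monom1 (0, m') - 1 :: int \<times> int \<Rightarrow>\<^sub>0 int"
  let ?X = "\<lambda>i. (i, 0) :: int \<times> int" and ?Y = "\<lambda>j. (0, j) :: int \<times> int"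
  have X: "?X (i + j) = ?X i + ?X j" "inj ?X" and Y: "?Y (i + j) = ?Y i + ?Y j" "inj ?Y" for i j
    by (auto simp: inj_def)
  let ?I = "{a. ?u dvd a}"
  have I: "is_ideal ?I" by (simp add: is_ideal_def dvd_diff)
  let ?\<rho> = "\<lambda>k. (fst k mod m, snd k) :: int \<times> int"
  have \<rho>: "monom1 k - monom1 (?\<rho> k) \<in> ?I" for k
  proof -
    have "monom1 (?\<rho> k) * (monom1 (?X (fst k div m * m)) - 1) = monom1 k - monom1 (?\<rho> k)"
      by (simp add: right_diff_distrib mult_single)
    moreover have "?u dvd monom1 (?X (fst k div m * m)) - 1"
      using unity_power_dvd[of ?X m "fst k div m", OF X(1)] .
    ultimately show ?thesis by (metis dvd_mult mem_Collect_eq)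
  qed
  obtain c0 where c0: "?u dvd c - c0" "Poly_Mapping.keys c0 \<subseteq> range ?\<rho>"
    using ideal_normal_form[OF I \<rho>, of c] by blast
  obtain e where e: "c - c0 = ?u * e" using c0(1) ..
  have c0_0: "lookup c0 k = 0" if "fst k < 0 \<or> m \<le> fst k" for k
  proof -
    have "k \<notin> range ?\<rho>"
    proof
      assume "k \<in> range ?\<rho>"
      then have "0 \<le> fst k \<and> fst k < m" using m by auto
      with that show False by linarith
    qed
    then show ?thesis using c0(2) by (auto simp: in_keys_iff)
  qed
  \<comment> \<open>Passing from \<open>c\<close> to its remainder \<open>c0\<close> changes the
    relation by a multiple of \<open>?u\<close>, absorbed here.\<close>
  define d' where "d' = d - ?w * e"
  have c: "c = c0 + ?u * e" using e by (simp add: algebra_simps)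
  have "?w * c0 - ?u * d' = ?w * c - ?u * d"
    unfolding c d'_def by (simp add: algebra_simps)
  with cd have cd': "of_int n dvd ?w * c0 - ?u * d'" by simp
  \<comment> \<open>Outside the strip \<open>c0\<close> and its translate in y have no coefficients,
    so \<open>d'\<close> repeats there with period \<open>m\<close> in x.\<close>
  have step: "n dvd lookup d' (k - (m, 0)) - lookup d' k" if k: "fst k < 0 \<or> m \<le> fst k" for k
  proof -
    have "n dvd lookup (?w * c0) k - lookup (?u * d') k"
      using cd' unfolding of_int_dvd_iff lookup_minus by blast
    moreover have "lookup (?w * c0) k = 0"
      using k c0_0[of k] c0_0[of "k - (0, m')"] by (simp add: lookup_unity_mult)
    ultimately have "n dvd lookup (?u * d') k" by simp
    then show ?thesis by (simp only: lookup_unity_mult)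
  qed
  \<comment> \<open>The progression runs left from a negative x-exponent and right otherwise. On the
    right the first relation is taken one period ahead, so it already lies beyond the strip.\<close>
  have "n dvd lookup d' k" for k
  proof (cases "fst k < 0")
    case True
    have per: "n dvd lookup d' (k + ?X (int i * - m)) - lookup d' (k + ?X ((int i + 1) * - m))" for i
    proof -
      have "fst k - int i * m < 0" using True m
        by (smt (verit) mult_nonneg_nonneg of_nat_0_le_iff)
      then have "n dvd lookup d' (k + ?X (int i * - m) - (m, 0)) - lookup d' (k + ?X (int i * - m))"
        by (intro step) simp
      moreover have "k + ?X (int i * - m) - (m, 0) = k + ?X ((int i + 1) * - m)"
        by (cases k) (simp add: algebra_simps)
      ultimately show ?thesis by (simp only: dvd_diff_commute)
    qed
    show ?thesis
      by (rule dvd_lookup_of_periodic[of ?X "- m" n d' k, OF X _ per]) (use m in simp)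
  next
    case False
    have per: "n dvd lookup d' (k + ?X (int i * m)) - lookup d' (k + ?X ((int i + 1) * m))" for i
    proof -
      have "m \<le> fst k + (int i + 1) * m" using False m
        by (simp add: distrib_right)
      then have "n dvd lookup d' (k + ?X ((int i + 1) * m) - (m, 0)) - lookup d' (k + ?X ((int i + 1) * m))"
        by (intro step) simp
      moreover have "k + ?X ((int i + 1) * m) - (m, 0) = k + ?X (int i * m)"
        by (cases k) (simp add: algebra_simps)
      ultimately show ?thesis by simp
    qed
    show ?thesis
      by (rule dvd_lookup_of_periodic[of ?X m n d' k, OF X _ per]) (use m in simp)
  qed
  then have "of_int n dvd d'" by (simp add: of_int_dvd_iff)
  then have "of_int n dvd (?w * c0 - ?u * d') + ?u * d'" using cd' by (intro dvd_add dvd_mult)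
  then have "of_int n dvd ?w * c0" by simp
  then have "of_int n dvd c0" using unity_nonzerodivisor[of ?Y m' n c0, OF Y] m' by simp
  then show ?thesis by (intro that[of e]) (simp add: c)
qed

lemma finite_index_imp_koszul_exact:
  fixes f g :: "int \<times> int \<Rightarrow>\<^sub>0 int"
  assumes fin: "finite_index (ideal3 (of_int n) f g)"
  shows "koszul_exact (of_int n) f g"
  unfolding koszul_exact_def
proof (intro allI impI)
  let ?I = "ideal3 (of_int n) f g"
  let ?X = "\<lambda>i. (i, 0) :: int \<times> int" and ?Y = "\<lambda>j. (0, j) :: int \<times> int"
  have X: "?X (i + j) = ?X i + ?X j" "inj ?X" and Y: "?Y (i + j) = ?Y i + ?Y j" for i j
    by (auto simp: inj_def)
  fix a b assume ab: "of_int n dvd a * f + b * g"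
  obtain S where S: "finite S" "\<And>r. \<exists>s\<in>S. r - s \<in> ?I"
    using fin unfolding finite_index_def by blast
  obtain m where m: "m > 0" "monom1 (?X m) - 1 \<in> ?I"
    by (rule pigeonhole_monom[of ?I ?X, OF is_ideal_ideal3 X(1) S])
  obtain m' where m': "m' > 0" "monom1 (?Y m') - 1 \<in> ?I"
    by (rule pigeonhole_monom[of ?I ?Y, OF is_ideal_ideal3 Y S])
  define u where "u = (monom1 (m, 0) - 1 :: int \<times> int \<Rightarrow>\<^sub>0 int)"
  define w where "w = (monom1 (0, m') - 1 :: int \<times> int \<Rightarrow>\<^sub>0 int)"
  \<comment> \<open>Contraction homotopy: \<open>z = r * f + s * g\<close> modulo \<open>n\<close>
    gives the multiplier \<open>s * a - r * b\<close>.\<close>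
  have annihilate: "\<exists>c. of_int n dvd z * a - c * g \<and> of_int n dvd z * b + c * f" if "z \<in> ?I" for z
  proof -
    obtain r s t where z: "z = r * f + s * g + of_int n * t" 
      using \<open>z \<in> ?I\<close> by (auto simp: ideal3_def)
    have "z * a - (s * a - r * b) * g = r * (a * f + b * g) + of_int n * (t * a)"
      "z * b + (s * a - r * b) * f = s * (a * f + b * g) + of_int n * (t * b)"
      unfolding z by (simp_all add: algebra_simps)
    then have "of_int n dvd z * a - (s * a - r * b) * g" "of_int n dvd z * b + (s * a - r * b) * f"
      using ab by simp_all
    then show ?thesis by blast
  qed
  obtain c where c: "of_int n dvd u * a - c * g" "of_int n dvd u * b + c * f"
    using annihilate[of u] m(2) unfolding u_def by blast
  obtain d where d: "of_int n dvd w * a - d * g" "of_int n dvd w * b + d * f"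
    using annihilate[of w] m'(2) unfolding w_def by blast
  obtain r s t where rst: "u = r * f + s * g + of_int n * t"
    using m(2) unfolding u_def by (auto simp: ideal3_def)
  have nonzerodivisor: "of_int n dvd z" if "of_int n dvd u * z" for z
    using unity_nonzerodivisor[of ?X m n z, OF X] m(1) that unfolding u_def by simp
  \<comment> \<open>The two combinations are \<open>w * c - u * d\<close> times \<open>f\<close> and
    times \<open>g\<close>. So this element annihilates \<open>f\<close> and \<open>g\<close> modulo
    \<open>n\<close>, hence also \<open>u\<close>, which is a nonzerodivisor.\<close>
  have 1: "of_int n dvd w * (u * b + c * f) - u * (w * b + d * f)"
    by (rule dvd_diff[OF dvd_mult[OF c(2)] dvd_mult[OF d(2)]])
  have 2: "of_int n dvd u * (w * a - d * g) - w * (u * a - c * g)"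
    by (rule dvd_diff[OF dvd_mult[OF d(1)] dvd_mult[OF c(1)]])
  have "u * (w * c - u * d) = r * (w * (u * b + c * f) - u * (w * b + d * f))
      + s * (u * (w * a - d * g) - w * (u * a - c * g)) + of_int n * (t * (w * c - u * d))"
    by (subst (1) rst) (simp add: algebra_simps)
  also have "of_int n dvd \<dots>"
    by (rule dvd_add[OF dvd_add[OF dvd_mult[OF 1] dvd_mult[OF 2]] dvd_triv_left])
  finally have "of_int n dvd w * c - u * d" by (rule nonzerodivisor)
  then obtain e where e: "of_int n dvd c - u * e"
    using unity_regular_sequence[OF m(1) m'(1)] unfolding u_def w_def by blast
  \<comment> \<open>Substituting \<open>c = u * e\<close> modulo \<open>n\<close> makes
    \<open>u\<close> a common factor, which cancels.\<close>
  have "u * (a - e * g) = (u * a - c * g) + (c - u * e) * g"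
    "u * (b + e * f) = (u * b + c * f) - (c - u * e) * f"
    by (simp_all add: algebra_simps)
  then have "of_int n dvd u * (a - e * g)" "of_int n dvd u * (b + e * f)"
    using c e by (simp_all add: dvd_add dvd_diff)
  then show "\<exists>c. of_int n dvd a - c * g \<and> of_int n dvd b + c * f"
    using nonzerodivisor by blast
qed

subsection \<open>Reduction modulo \<open>N\<close> and the check matrices\<close>

lemma of_int_mod_ring_hom:
  fixes a b :: int
  shows "(of_int_mod_ring (a + b) :: 'n::finite mod_ring) = of_int_mod_ring a + of_int_mod_ring b"
    and "(of_int_mod_ring (a - b) :: 'n::finite mod_ring) = of_int_mod_ring a - of_int_mod_ring b"
    and "(of_int_mod_ring (a * b) :: 'n::finite mod_ring) = of_int_mod_ring a * of_int_mod_ring b"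
  by (transfer; simp add: mod_simps)+

lemma of_int_mod_ring_eq_0_iff:
  "(of_int_mod_ring c :: 'n::finite mod_ring) = 0 \<longleftrightarrow> int CARD('n) dvd c"
  by transfer (simp add: mod_eq_0_iff_dvd)

lemma of_int_mod_ring_sum:
  "(of_int_mod_ring (sum h F) :: 'n::finite mod_ring) = (\<Sum>k\<in>F. of_int_mod_ring (h k))"
  by (induction F rule: infinite_finite_induct) (simp_all add: of_int_mod_ring_hom)

definition reduce_laurent :: "(int \<times> int \<Rightarrow>\<^sub>0 int) \<Rightarrow> 'n::finite laurent" where
  "reduce_laurent = Poly_Mapping.map of_int_mod_ring"

text \<open>Only a section of the reduction: it respects sums and products merely modulo
  \<open>N\<close>, so identities are compared after reducing.\<close>

definition lift_laurent :: "'n::finite laurent \<Rightarrow> (int \<times> int \<Rightarrow>\<^sub>0 int)" where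
  "lift_laurent = Poly_Mapping.map to_int_mod_ring"

lemma lookup_reduce: "lookup (reduce_laurent a) k = of_int_mod_ring (lookup a k)"
  by (simp add: reduce_laurent_def Poly_Mapping.map.rep_eq when_def)

lemma reduce_lift [simp]: "reduce_laurent (lift_laurent a) = a"
  by (rule poly_mapping_eqI)
    (simp add: lookup_reduce lift_laurent_def Poly_Mapping.map.rep_eq when_def)

lemma reduce_add: "reduce_laurent (a + b) = reduce_laurent a + reduce_laurent b"
  by (rule poly_mapping_eqI) (simp add: lookup_reduce lookup_add of_int_mod_ring_hom)

lemma reduce_diff: "reduce_laurent (a - b) = reduce_laurent a - reduce_laurent b"
  by (rule poly_mapping_eqI) (simp add: lookup_reduce lookup_minus of_int_mod_ring_hom)

lemma reduce_mult: "reduce_laurent (a * b) = reduce_laurent a * reduce_laurent b"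
proof (rule poly_mapping_eqI)
  fix k
  have sub: "Poly_Mapping.keys (reduce_laurent a) \<subseteq> Poly_Mapping.keys a"
    by (auto simp: in_keys_iff lookup_reduce intro: ccontr)
  show "lookup (reduce_laurent (a * b)) k = lookup (reduce_laurent a * reduce_laurent b) k"
    by (simp add: lookup_mult_group[OF finite_keys sub] lookup_mult_group[OF finite_keys order_refl, of a]
        lookup_reduce of_int_mod_ring_sum of_int_mod_ring_hom)
qed

lemma reduce_one_mult: "reduce_laurent 1 * a = (a :: 'n::finite laurent)"
proof -
  have "reduce_laurent (1 * lift_laurent a) = (reduce_laurent 1 * reduce_laurent (lift_laurent a) :: 'n laurent)"
    by (rule reduce_mult)
  then show ?thesis by simp
qed

lemma reduce_eq_0_iff:
  "(reduce_laurent a :: 'n::finite laurent) = 0 \<longleftrightarrow> of_int (int CARD('n)) dvd a"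
  by (simp only: of_int_dvd_iff poly_mapping_eq_iff fun_eq_iff lookup_reduce lookup_zero
      of_int_mod_ring_eq_0_iff)

lemma reduce_eq_iff:
  "(reduce_laurent a :: 'n::finite laurent) = reduce_laurent b \<longleftrightarrow> of_int (int CARD('n)) dvd a - b"
  unfolding reduce_eq_0_iff[symmetric] reduce_diff by simp

lemma koszul_exact_lift_iff:
  fixes f g :: "'n::finite laurent"
  shows "koszul_exact (of_int (int CARD('n))) (lift_laurent f) (lift_laurent g) \<longleftrightarrow>
    (\<forall>a b. a * f + b * g = 0 \<longrightarrow> (\<exists>c. a = c * g \<and> b + c * f = 0))"
  (is "?L \<longleftrightarrow> ?R")
proof
  assume L: ?L
  show ?R
  proof (intro allI impI)
    fix a b assume "a * f + b * g = 0"
    then have "(reduce_laurent (lift_laurent a * lift_laurent f + lift_laurent b * lift_laurent g)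
        :: 'n laurent) = 0"
      by (simp add: reduce_add reduce_mult)
    then obtain c where "of_int (int CARD('n)) dvd lift_laurent a - c * lift_laurent g"
      "of_int (int CARD('n)) dvd lift_laurent b + c * lift_laurent f"
      unfolding reduce_eq_0_iff using koszul_exactD[OF L] by blast
    then have "a = reduce_laurent c * g \<and> b + reduce_laurent c * f = 0"
      by (simp only: reduce_eq_0_iff[symmetric, where 'n = 'n] reduce_add reduce_mult reduce_lift
          reduce_diff right_minus_eq)
    then show "\<exists>c. a = c * g \<and> b + c * f = 0" by blast
  qed
next
  assume R: ?R
  show ?L
    unfolding koszul_exact_def
  proof (intro allI impI)
    fix a b assume "of_int (int CARD('n)) dvd a * lift_laurent f + b * lift_laurent g"
    then have "reduce_laurent a * f + reduce_laurent b * g = 0"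
      by (simp only: reduce_eq_0_iff[symmetric, where 'n = 'n] reduce_add reduce_mult reduce_lift)
    then obtain c where "reduce_laurent a = c * g" "reduce_laurent b + c * f = 0"
      using R by blast
    then have "(reduce_laurent (a - lift_laurent c * lift_laurent g) :: 'n laurent) = 0"
      "(reduce_laurent (b + lift_laurent c * lift_laurent f) :: 'n laurent) = 0"
      by (simp_all add: reduce_add reduce_diff reduce_mult)
    then show "\<exists>c. of_int (int CARD('n)) dvd a - c * lift_laurent g \<and>
        of_int (int CARD('n)) dvd b + c * lift_laurent f"
      unfolding reduce_eq_0_iff by blast
  qed
qed

text \<open>\<open>'n laurent\<close> is not an instance of \<open>comm_ring_1\<close>, because \<open>N = 1\<close> is allowed; 
  \<open>reduce_laurent 1\<close> serves as the unit.\<close>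

lemma ideal_generated_pair:
  fixes f g :: "'n::finite laurent"
  shows "ideal_generated {f, g} = {u * f + v * g | u v. True}" (is "_ = ?I")
proof
  have "is_ideal ?I"
    unfolding is_ideal_def
  proof (intro conjI ballI allI)
    have "0 = 0 * f + 0 * g" by simp
    then show "0 \<in> ?I" by blast
  next
    fix a b assume "a \<in> ?I" "b \<in> ?I"
    then obtain u v u' v' where "a = u * f + v * g" "b = u' * f + v' * g" by blast
    then have "a - b = (u - u') * f + (v - v') * g" by (simp add: algebra_simps)
    then show "a - b \<in> ?I" by blast
  next
    fix r a assume "a \<in> ?I"
    then obtain u v where "a = u * f + v * g" by blast
    then have "r * a = (r * u) * f + (r * v) * g" by (simp add: algebra_simps)
    then show "r * a \<in> ?I" by blast
  qed
  moreover have "f = reduce_laurent 1 * f + 0 * g" "g = 0 * f + reduce_laurent 1 * g"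
    by (simp_all add: reduce_one_mult)
  then have "{f, g} \<subseteq> ?I" by blast
  ultimately show "ideal_generated {f, g} \<subseteq> ?I" unfolding ideal_generated_def by blast
  show "?I \<subseteq> ideal_generated {f, g}"
  proof
    fix a assume "a \<in> ?I"
    then obtain u v where a: "a = u * f + v * g" by blast
    have "a \<in> J" if J: "is_ideal J" "{f, g} \<subseteq> J" for J
    proof -
      have sub: "x - y \<in> J" if "x \<in> J" "y \<in> J" for x y
        using J(1) that by (simp add: is_ideal_def)
      have "0 \<in> J" "u * f \<in> J" "v * g \<in> J" using J by (simp_all add: is_ideal_def)
      \<comment> \<open>Ideals are closed under differences by definition, so the sum is written as
        a double difference.\<close>
      then have "u * f - (0 - v * g) \<in> J" by (intro sub)
      then show ?thesis by (simp add: a)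
    qed
    then show "a \<in> ideal_generated {f, g}" unfolding ideal_generated_def by blast
  qed
qed

lemma is_ideal_ideal_generated: "is_ideal (ideal_generated S)"
  unfolding ideal_generated_def is_ideal_def by blast

lemma reduce_in_ideal_iff:
  fixes f g :: "'n::finite laurent"
  shows "reduce_laurent r \<in> ideal_generated {f, g} \<longleftrightarrow>
    r \<in> ideal3 (of_int (int CARD('n))) (lift_laurent f) (lift_laurent g)"
    (is "_ \<longleftrightarrow> r \<in> ?I")
proof
  assume "reduce_laurent r \<in> ideal_generated {f, g}"
  then obtain u v where "reduce_laurent r = u * f + v * g" unfolding ideal_generated_pair by blast
  then have "(reduce_laurent r :: 'n laurent)
      = reduce_laurent (lift_laurent u * lift_laurent f + lift_laurent v * lift_laurent g)"
    by (simp add: reduce_add reduce_mult)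
  then obtain w where "r - (lift_laurent u * lift_laurent f + lift_laurent v * lift_laurent g)
      = of_int (int CARD('n)) * w"
    unfolding reduce_eq_iff ..
  then have "r = lift_laurent u * lift_laurent f + lift_laurent v * lift_laurent g
      + of_int (int CARD('n)) * w" by (simp only: diff_eq_eq add.commute)
  then show "r \<in> ?I" unfolding ideal3_def by blast
next
  assume "r \<in> ?I"
  then obtain u v w where r: "r = u * lift_laurent f + v * lift_laurent g + of_int (int CARD('n)) * w"
    unfolding ideal3_def by blast
  have "(reduce_laurent (of_int (int CARD('n)) * w) :: 'n laurent) = 0"
    unfolding reduce_eq_0_iff by (rule dvd_triv_left)
  then have "reduce_laurent r = reduce_laurent u * f + reduce_laurent v * g"
    unfolding r by (simp only: reduce_add reduce_mult[of _ "lift_laurent _"] reduce_lift add_0_right)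
  then show "reduce_laurent r \<in> ideal_generated {f, g}" unfolding ideal_generated_pair by blast
qed

lemma finite_index_lift_iff:
  fixes f g :: "'n::finite laurent"
  shows "finite_index (ideal3 (of_int (int CARD('n))) (lift_laurent f) (lift_laurent g)) \<longleftrightarrow>
    finite_index (ideal_generated {f, g})"
  unfolding finite_index_def reduce_in_ideal_iff[symmetric, where 'n = 'n] reduce_diff
proof (intro iffI; elim exE conjE)
  fix S assume S: "finite S"
    "\<forall>r. \<exists>s\<in>S. reduce_laurent r - reduce_laurent s \<in> ideal_generated {f, g}"
  have "\<exists>s\<in>reduce_laurent ` S. r - s \<in> ideal_generated {f, g}" for r
    using S(2)[rule_format, of "lift_laurent r"] by simp
  with S(1) show "\<exists>S. finite S \<and> (\<forall>r. \<exists>s\<in>S. r - s \<in> ideal_generated {f, g})"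
    by (intro exI[of _ "reduce_laurent ` S"]) simp
next
  fix S assume S: "finite S" "\<forall>r. \<exists>s\<in>S. r - s \<in> ideal_generated {f, g}"
  then show "\<exists>S. finite S \<and>
      (\<forall>r. \<exists>s\<in>S. reduce_laurent r - reduce_laurent s \<in> ideal_generated {f, g})"
    by (intro exI[of _ "lift_laurent ` S"]) simp
qed

section \<open>The bar involution\<close>

lemma laurent_bar_mult: "laurent_bar (a * b) = laurent_bar a * laurent_bar b"
proof (rule poly_mapping_eqI)
  fix k :: "int \<times> int"
  have bar: "lookup (laurent_bar h) k = lookup h (- k)" for h :: "'n::finite laurent" and k
    by (cases k) (simp add: lookup_laurent_bar)
  have keys: "Poly_Mapping.keys (laurent_bar a) \<subseteq> uminus ` Poly_Mapping.keys a"
    by (auto simp: in_keys_iff bar image_iff intro!: bexI[of _ "- _"])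
  have "lookup (laurent_bar a * laurent_bar b) k
      = (\<Sum>l\<in>uminus ` Poly_Mapping.keys a. lookup a (- l) * lookup b (- (k - l)))"
    by (subst lookup_mult_group[OF _ keys]) (simp_all add: bar)
  also have "\<dots> = (\<Sum>l\<in>Poly_Mapping.keys a. lookup a l * lookup b (- k - l))"
  proof -
    have "inj_on uminus (Poly_Mapping.keys a)" by (auto simp: inj_on_def)
    moreover have "- (k - - l) = - k - l" for l by simp
    ultimately show ?thesis by (simp only: sum.reindex o_def minus_minus)
  qed
  also have "\<dots> = lookup (laurent_bar (a * b)) k"
    by (simp add: bar lookup_mult_group[OF finite_keys order_refl, of a])
  finally show "lookup (laurent_bar (a * b)) k = lookup (laurent_bar a * laurent_bar b) k" ..
qed

lemma laurent_bar_simps [simp]: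
  "laurent_bar (laurent_bar a) = a" "laurent_bar (- a) = - laurent_bar a"
  "laurent_bar (a + b) = laurent_bar a + laurent_bar b" "laurent_bar 0 = 0"
  by (rule poly_mapping_eqI; simp add: lookup_laurent_bar lookup_add split_paired_all)+

section \<open>Kernel and image of the check matrices in coordinates\<close>

lemma bb_syndrome_mult:
  assumes "v \<in> carrier_vec 4"
  shows "bb_syndrome f g *\<^sub>v v = vec_of_list
    [f * v $ 2 + g * v $ 3, - laurent_bar g * v $ 0 + laurent_bar f * v $ 1]"
  using assms
  by (intro eq_vecI)
    (auto simp: bb_syndrome_def mat_of_rows_list_def scalar_prod_def less_Suc_eq
      vec_of_list_index numeral_eq_Suc)

lemma bb_boundary_mult:
  assumes "v \<in> carrier_vec 2"
  shows "bb_boundary f g *\<^sub>v v = vec_of_list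
    [laurent_bar f * v $ 0, laurent_bar g * v $ 0, g * v $ 1, - f * v $ 1]"
  using assms
  by (intro eq_vecI)
    (auto simp: bb_boundary_def mat_of_rows_list_def scalar_prod_def less_Suc_eq
      vec_of_list_index numeral_eq_Suc)

lemma bb_dims:
  "dim_row (bb_syndrome f g) = 2" "dim_col (bb_syndrome f g) = 4"
  "dim_row (bb_boundary f g) = 4" "dim_col (bb_boundary f g) = 2"
  by (simp_all add: bb_syndrome_def bb_boundary_def mat_of_rows_list_def)

lemma vec_of_list_eq_iff: "vec_of_list xs = vec_of_list ys \<longleftrightarrow> xs = ys"
  by (metis list_vec)

lemma carrier_vec_2_eq: "carrier_vec 2 = {vec_of_list [a, b] | a b :: 'a. True}"
proof -
  have "v = vec_of_list [v $ 0, v $ 1]" if "v \<in> carrier_vec 2" for v :: "'a vec"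
    using that by (intro eq_vecI) (auto simp: less_Suc_eq vec_of_list_index numeral_eq_Suc)
  moreover have "vec_of_list [a, b] \<in> carrier_vec 2" for a b :: 'a by (rule carrier_vecI) simp
  ultimately show ?thesis by blast
qed

lemma carrier_vec_4_eq: "carrier_vec 4 = {vec_of_list [a, b, c, d] | a b c d :: 'a. True}"
proof -
  have "v = vec_of_list [v $ 0, v $ 1, v $ 2, v $ 3]" if "v \<in> carrier_vec 4" for v :: "'a vec"
    using that by (intro eq_vecI) (auto simp: less_Suc_eq vec_of_list_index numeral_eq_Suc)
  moreover have "vec_of_list [a, b, c, d] \<in> carrier_vec 4" for a b c d :: 'a by (rule carrier_vecI) simp
  ultimately show ?thesis by blast
qed

lemma mat_ker_bb_syndrome:
  fixes f g :: "'n::finite laurent"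
  shows "mat_ker (bb_syndrome f g) = {vec_of_list [a, b, c, d] | a b c d.
     f * c + g * d = 0 \<and> - laurent_bar g * a + laurent_bar f * b = 0}"
proof -
  have zero: "0\<^sub>v 2 = vec_of_list [0, 0 :: 'n laurent]"
    by (intro eq_vecI) (auto simp: less_Suc_eq vec_of_list_index numeral_eq_Suc)
  have "bb_syndrome f g *\<^sub>v vec_of_list [a, b, c, d] = 0\<^sub>v 2 \<longleftrightarrow>
      f * c + g * d = 0 \<and> - laurent_bar g * a + laurent_bar f * b = 0" for a b c d
    by (subst bb_syndrome_mult) (auto simp: zero vec_of_list_eq_iff vec_of_list_index
        intro!: carrier_vecI simp del: vec_of_list_Cons)
  then show ?thesis unfolding mat_ker_def bb_dims carrier_vec_4_eq by blast
qed

lemma mat_im_bb_boundary: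
  "mat_im (bb_boundary f g) = {vec_of_list [laurent_bar f * s, laurent_bar g * s, g * t, - f * t] | s t. True}"
proof -
  have "bb_boundary f g *\<^sub>v vec_of_list [s, t] =
      vec_of_list [laurent_bar f * s, laurent_bar g * s, g * t, - f * t]" for s t
    by (subst bb_boundary_mult) (auto simp: vec_of_list_index
        intro!: carrier_vecI simp del: vec_of_list_Cons)
  moreover have "mat_im (bb_boundary f g) = {bb_boundary f g *\<^sub>v vec_of_list [s, t] | s t. True}"
    unfolding mat_im_def bb_dims carrier_vec_2_eq by blast
  ultimately show ?thesis by (simp only:)
qed

text \<open>Applying the bar involution to the second row of the syndrome matrix turns its exactness
  condition into that of the first row.\<close>

lemma bb_topological_iff:
  "bb_topological f g \<longleftrightarrow> (\<forall>a b. a * f + b * g = 0 \<longrightarrow> (\<exists>c. a = c * g \<and> b + c * f = 0))"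
  (is "_ \<longleftrightarrow> ?R")
proof
  assume "bb_topological f g"
  then have eq: "mat_ker (bb_syndrome f g) = mat_im (bb_boundary f g)" by (simp add: bb_topological_def)
  show ?R
  proof (intro allI impI)
    fix a b assume "a * f + b * g = 0"
    then have "f * a + g * b = 0" by (simp add: mult.commute)
    \<comment> \<open>The two rows act on disjoint pairs of coordinates, so a relation for the first
      row extends by zeros.\<close>
    then have "vec_of_list [0, 0, a, b] \<in> mat_ker (bb_syndrome f g)"
      unfolding mat_ker_bb_syndrome by force
    then obtain s t where "vec_of_list [0, 0, a, b] =
        vec_of_list [laurent_bar f * s, laurent_bar g * s, g * t, - f * t]"
      unfolding eq mat_im_bb_boundary by blast
    then have "a = g * t" "b = - f * t" unfolding vec_of_list_eq_iff by blast+
    then show "\<exists>c. a = c * g \<and> b + c * f = 0" by (auto simp: mult.commute)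
  qed
next
  assume R: ?R
  have "mat_ker (bb_syndrome f g) \<subseteq> mat_im (bb_boundary f g)"
  proof
    fix v assume "v \<in> mat_ker (bb_syndrome f g)"
    then obtain a b c d where v: "v = vec_of_list [a, b, c, d]" and "f * c + g * d = 0"
      and ab: "- laurent_bar g * a + laurent_bar f * b = 0"
      unfolding mat_ker_bb_syndrome by blast
    then have "c * f + d * g = 0" by (simp add: mult.commute)
    then obtain t where t: "c = t * g" "d + t * f = 0" using R by blast
    have "laurent_bar (- laurent_bar g * a + laurent_bar f * b) = 0" unfolding ab by simp
    then have "- g * laurent_bar a + f * laurent_bar b = 0"
      by (simp only: laurent_bar_mult laurent_bar_simps)
    then have "laurent_bar b * f + (- laurent_bar a) * g = 0"
      by (simp add: mult.commute)
    then obtain s where s: "laurent_bar b = s * g" "- laurent_bar a + s * f = 0" using R by blast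
    have "laurent_bar (laurent_bar b) = laurent_bar (s * g)" using s(1) by simp
    then have "b = laurent_bar g * laurent_bar s" by (simp add: laurent_bar_mult mult.commute)
    moreover have "laurent_bar a = s * f" using s(2) by (simp add: neg_eq_iff_add_eq_0[symmetric])
    then have "laurent_bar (laurent_bar a) = laurent_bar (s * f)" by simp
    then have "a = laurent_bar f * laurent_bar s" by (simp add: laurent_bar_mult mult.commute)
    moreover have "c = g * t" using t(1) by (simp add: mult.commute)
    moreover have "d = - f * t" using t(2) by (simp add: eq_neg_iff_add_eq_0 mult.commute)
    ultimately show "v \<in> mat_im (bb_boundary f g)" unfolding mat_im_bb_boundary v by blast
  qed
  \<comment> \<open>The chain complex identity, which holds by commutativity.\<close>
  moreover have "mat_im (bb_boundary f g) \<subseteq> mat_ker (bb_syndrome f g)"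
    unfolding mat_im_bb_boundary mat_ker_bb_syndrome by (force simp: mult.left_commute mult.commute)
  ultimately show "bb_topological f g" unfolding bb_topological_def by blast
qed

theorem corollary1:
  fixes f g :: "'n::finite laurent"
  shows "bb_topological f g \<longleftrightarrow> finite (quotient_by (ideal_generated {f, g}))"
proof -
  have "int CARD('n) > 0" by simp
  then have "koszul_exact (of_int (int CARD('n))) (lift_laurent f) (lift_laurent g) \<longleftrightarrow>
      finite_index (ideal3 (of_int (int CARD('n))) (lift_laurent f) (lift_laurent g))"
    using koszul_exact_imp_finite_index finite_index_imp_koszul_exact by blast
  then show ?thesis
    unfolding koszul_exact_lift_iff finite_index_lift_iff bb_topological_iff
      finite_quotient_iff[OF is_ideal_ideal_generated] .
qed

end
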